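(* Let $\mathbf{K}$ be an $\omega$-homogeneous relational structure. Then $\mathrm{Aut}(\mathbf{K})$ is CAP if and only if $\mathrm{Age}(\mathbf{K})$ has finite Ramsey degrees.
   Context: For a relational structure $\mathbf{K}$ in a language $L$ (of arbitrary cardinality), $\mathrm{Age}(\mathbf{K})$ is the class of finite $L$-structures which embed into $\mathbf{K}$. $\mathbf{K}$ is $\omega$-homogeneous if any isomorphism between finite substructures of $\mathbf{K}$ extends to an automorphism of $\mathbf{K}$. $\mathrm{Aut}(\mathbf{K})$ is a topological group with the topology of pointwise convergence (with $\mathbf{K}$ discrete), i.e. pointwise stabilizers of finite subsets form a neighborhood basis of the identity. $\mathrm{Emb}(\mathbf{A},\mathbf{B})$ is the set of embeddings of $\mathbf{A}$ into $\mathbf{B}$, and $\mathbf{A}\le\mathbf{B}$ means $\mathrm{Emb}(\mathbf{A},\mathbf{B})\ne\emptyset$. Given $\mathbf{A}\in\mathrm{Age}(\mathbf{K})$ and $k<\omega$, $\mathbf{A}$ has Ramsey degree $k$ if $k$ is least such that for all natural numbers $r\ge k$ and all $\mathbf{B}\in\mathrm{Age}(\mathbf{K})$ with $\mathbf{A}\le\mathbf{B}$ there is $\mathbf{C}\in\mathrm{Age}(\mathbf{K})$ with $\mathbf{B}\le\mathbf{C}$ such that for each coloring $\gamma:\mathrm{Emb}(\mathbf{A},\mathbf{C})\to r$ there is $i\in\mathrm{Emb}(\mathbf{B},\mathbf{C})$ with $|\{\gamma(i\circ j): j\in\mathrm{Emb}(\mathbf{A},\mathbf{B})\}|\le k$.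 $\mathrm{Age}(\mathbf{K})$ has finite Ramsey degrees if every $\mathbf{A}\in\mathrm{Age}(\mathbf{K})$ has Ramsey degree $k$ for some $k<\omega$. For a (Hausdorff) topological group $G$, a $G$-flow is a (non-empty) compact Hausdorff space with a continuous left $G$-action; a subflow is a non-empty closed invariant subset; a flow is minimal if it has no proper subflow. For a $G$-flow $X$, $\mathrm{AP}_G(X)=\{x\in X:\overline{Gx}\text{ is minimal}\}$. $G$ is CAP if $\mathrm{AP}_G(X)$ is closed in $X$ for every $G$-flow $X$. *)

theory Defs
  imports "HOL-Analysis.Analysis" "HOL-Algebra.Group_Action"
begin

section \<open>Relational structures\<close>

text \<open>The symbols form a set rather than a whole type, so that the empty language is included;
  arity 0 and empty structures are allowed.\<close>

record 'r language =
  symbols :: "'r set"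
  arity :: "'r \<Rightarrow> nat"

record ('a, 'r) rel_struct =
  universe :: "'a set"
  interp :: "'r \<Rightarrow> 'a list set"

definition tuples :: "'a set \<Rightarrow> nat \<Rightarrow> 'a list set" where
  "tuples A n = {xs. length xs = n \<and> set xs \<subseteq> A}"

definition is_structure :: "'r language \<Rightarrow> ('a, 'r) rel_struct \<Rightarrow> bool" where
  "is_structure L A \<longleftrightarrow> (\<forall>R\<in>symbols L. interp A R \<subseteq> tuples (universe A) (arity L R))"

text \<open>Embeddings are extensional functions, so that each embedding is counted only once.\<close>

definition Emb :: "'r language \<Rightarrow> ('a, 'r) rel_struct \<Rightarrow> ('b, 'r) rel_struct \<Rightarrow> ('a \<Rightarrow> 'b) set" where
  "Emb L A B = {f \<in> universe A \<rightarrow>\<^sub>E universe B. inj_on f (universe A) \<and>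
     (\<forall>R\<in>symbols L. \<forall>xs\<in>tuples (universe A) (arity L R). xs \<in> interp A R \<longleftrightarrow> map f xs \<in> interp B R)}"

definition embeds :: "'r language \<Rightarrow> ('a, 'r) rel_struct \<Rightarrow> ('b, 'r) rel_struct \<Rightarrow> bool" where
  "embeds L A B \<longleftrightarrow> Emb L A B \<noteq> {}"

definition isos :: "'r language \<Rightarrow> ('a, 'r) rel_struct \<Rightarrow> ('b, 'r) rel_struct \<Rightarrow> ('a \<Rightarrow> 'b) set" where
  "isos L A B = {f \<in> Emb L A B. f ` universe A = universe B}"

abbreviation Aut :: "'r language \<Rightarrow> ('a, 'r) rel_struct \<Rightarrow> ('a \<Rightarrow> 'a) set" where
  "Aut L K \<equiv> isos L K K"

definition substructure :: "('a, 'r) rel_struct \<Rightarrow> 'a set \<Rightarrow> ('a, 'r) rel_struct" where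
  "substructure K X = \<lparr>universe = X, interp = (\<lambda>R. {xs \<in> interp K R. set xs \<subseteq> X})\<rparr>"

definition omega_homogeneous :: "'r language \<Rightarrow> ('a, 'r) rel_struct \<Rightarrow> bool" where
  "omega_homogeneous L K \<longleftrightarrow>
     (\<forall>X Y f. finite X \<and> X \<subseteq> universe K \<and> finite Y \<and> Y \<subseteq> universe K \<and>
        f \<in> isos L (substructure K X) (substructure K Y) \<longrightarrow>
        (\<exists>g\<in>Aut L K. \<forall>x\<in>X. g x = f x))"

text \<open>It is enough to take the members of the age inside the type of \<^term>\<open>K\<close>: every finite
  structure embedding into \<^term>\<open>K\<close>, on whatever type, is isomorphic to its image in \<^term>\<open>K\<close>.\<close>

definition Age :: "'r language \<Rightarrow> ('a, 'r) rel_struct \<Rightarrow> ('a, 'r) rel_struct set" where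
  "Age L K = {A. is_structure L A \<and> finite (universe A) \<and> embeds L A K}"


section \<open>Ramsey degrees\<close>

text \<open>Colorings with \<^term>\<open>r\<close> colors take values in \<^term>\<open>{..<r}\<close>; the term
  \<^term>\<open>compose (universe A) i j\<close> is the (extensional) composition of
  \<^term>\<open>j \<in> Emb L A B\<close> and \<^term>\<open>i \<in> Emb L B C\<close>.\<close>

definition ramsey_bound :: "'r language \<Rightarrow> ('a, 'r) rel_struct \<Rightarrow> ('a, 'r) rel_struct \<Rightarrow> nat \<Rightarrow> bool" where
  "ramsey_bound L K A k \<longleftrightarrow>
     (\<forall>r\<ge>k. \<forall>B\<in>Age L K. embeds L A B \<longrightarrow>
        (\<exists>C\<in>Age L K. embeds L B C \<and>
           (\<forall>\<gamma>\<in>Emb L A C \<rightarrow> {..<r}. \<exists>i\<in>Emb L B C.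
              card {\<gamma> (compose (universe A) i j) | j. j \<in> Emb L A B} \<le> k)))"

definition has_ramsey_degree :: "'r language \<Rightarrow> ('a, 'r) rel_struct \<Rightarrow> ('a, 'r) rel_struct \<Rightarrow> nat \<Rightarrow> bool" where
  "has_ramsey_degree L K A k \<longleftrightarrow> ramsey_bound L K A k \<and> (\<forall>m. ramsey_bound L K A m \<longrightarrow> k \<le> m)"

definition finite_ramsey_degrees :: "'r language \<Rightarrow> ('a, 'r) rel_struct \<Rightarrow> bool" where
  "finite_ramsey_degrees L K \<longleftrightarrow> (\<forall>A\<in>Age L K. \<exists>k. has_ramsey_degree L K A k)"


section \<open>The automorphism group\<close>

definition aut_group :: "'r language \<Rightarrow> ('a, 'r) rel_struct \<Rightarrow> ('a \<Rightarrow> 'a) monoid" where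
  "aut_group L K = (BijGroup (universe K)) \<lparr>carrier := Aut L K\<rparr>"

definition aut_topology :: "'r language \<Rightarrow> ('a, 'r) rel_struct \<Rightarrow> ('a \<Rightarrow> 'a) topology" where
  "aut_topology L K =
     subtopology (product_topology (\<lambda>_. discrete_topology (universe K)) (universe K)) (Aut L K)"

lemma Aut_iff:
  "f \<in> Aut L K \<longleftrightarrow> f \<in> Bij (universe K) \<and>
     (\<forall>R\<in>symbols L. \<forall>xs\<in>tuples (universe K) (arity L R). xs \<in> interp K R \<longleftrightarrow> map f xs \<in> interp K R)"
  unfolding isos_def Emb_def Bij_def bij_betw_def PiE_def by blast

lemma map_tuples: "f \<in> Bij A \<Longrightarrow> xs \<in> tuples A n \<Longrightarrow> map f xs \<in> tuples A n"
  by (auto simp: tuples_def Bij_def bij_betw_def)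

lemma group_aut_group: "group (aut_group L K)"
proof -
  let ?U = "universe K"
  have "subgroup (Aut L K) (BijGroup ?U)"
  proof (rule group.subgroupI[OF group_BijGroup])
    show "Aut L K \<subseteq> carrier (BijGroup ?U)"
      by (auto simp: BijGroup_def Aut_iff)
    have "map (restrict (\<lambda>x. x) ?U) xs = xs" if "xs \<in> tuples ?U n" for xs n
      using that by (intro map_idI) (auto simp: tuples_def)
    then have "restrict (\<lambda>x. x) ?U \<in> Aut L K"
      by (simp add: Aut_iff id_Bij)
    then show "Aut L K \<noteq> {}" by blast
  next
    fix f assume f: "f \<in> Aut L K"
    then have fB: "f \<in> Bij ?U" by (simp add: Aut_iff)
    let ?g = "restrict (inv_into ?U f) ?U"
    have gB: "?g \<in> Bij ?U" by (rule restrict_inv_into_Bij[OF fB])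
    have "xs \<in> interp K R \<longleftrightarrow> map ?g xs \<in> interp K R"
      if R: "R \<in> symbols L" and xs: "xs \<in> tuples ?U (arity L R)" for R xs
    proof -
      have "map f (map ?g xs) = xs"
        using xs fB unfolding map_map
        by (intro map_idI) (auto simp: tuples_def Bij_def bij_betw_def f_inv_into_f subset_iff)
      then show ?thesis
        using f R map_tuples[OF gB xs] unfolding Aut_iff by metis
    qed
    then show "inv\<^bsub>BijGroup ?U\<^esub> f \<in> Aut L K"
      unfolding inv_BijGroup[OF fB] Aut_iff using gB by blast
  next
    fix f g assume f: "f \<in> Aut L K" and g: "g \<in> Aut L K"
    then have fB: "f \<in> Bij ?U" and gB: "g \<in> Bij ?U" by (simp_all add: Aut_iff)
    have "xs \<in> interp K R \<longleftrightarrow> map (compose ?U f g) xs \<in> interp K R"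
      if R: "R \<in> symbols L" and xs: "xs \<in> tuples ?U (arity L R)" for R xs
    proof -
      have "map (compose ?U f g) xs = map f (map g xs)"
        using xs by (auto simp: tuples_def compose_def)
      then show ?thesis
        using f g R xs map_tuples[OF gB xs] unfolding Aut_iff by metis
    qed
    then have "compose ?U f g \<in> Aut L K"
      unfolding Aut_iff using compose_Bij[OF fB gB] by blast
    then show "f \<otimes>\<^bsub>BijGroup ?U\<^esub> g \<in> Aut L K"
      using fB gB by (simp add: BijGroup_def)
  qed
  then show ?thesis
    unfolding aut_group_def by (rule subgroup.subgroup_is_group[OF _ group_BijGroup])
qed


section \<open>Flows\<close>

text \<open>A topological group is given by a group \<^term>\<open>G\<close> and a topology \<^term>\<open>T\<close> on
  \<^term>\<open>carrier G\<close>.\<close>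

definition flow ::
  "('g, 'm) monoid_scheme \<Rightarrow> 'g topology \<Rightarrow> 'x topology \<Rightarrow> ('g \<Rightarrow> 'x \<Rightarrow> 'x) \<Rightarrow> bool" where
  "flow G T X \<phi> \<longleftrightarrow>
     topspace X \<noteq> {} \<and> compact_space X \<and> Hausdorff_space X \<and>
     group_action G (topspace X) \<phi> \<and>
     continuous_map (prod_topology T X) X (\<lambda>(g, x). \<phi> g x)"

definition subflow ::
  "('g, 'm) monoid_scheme \<Rightarrow> 'x topology \<Rightarrow> ('g \<Rightarrow> 'x \<Rightarrow> 'x) \<Rightarrow> 'x set \<Rightarrow> bool" where
  "subflow G X \<phi> Y \<longleftrightarrow>
     Y \<noteq> {} \<and> closedin X Y \<and> (\<forall>g\<in>carrier G. \<phi> g ` Y \<subseteq> Y)"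

definition minimal_flow ::
  "('g, 'm) monoid_scheme \<Rightarrow> 'g topology \<Rightarrow> 'x topology \<Rightarrow> ('g \<Rightarrow> 'x \<Rightarrow> 'x) \<Rightarrow> bool" where
  "minimal_flow G T X \<phi> \<longleftrightarrow>
     flow G T X \<phi> \<and> (\<forall>Y. subflow G X \<phi> Y \<longrightarrow> Y = topspace X)"

text \<open>The action is restricted to the orbit closure because library group actions are extensional.\<close>

definition AP ::
  "('g, 'm) monoid_scheme \<Rightarrow> 'g topology \<Rightarrow> 'x topology \<Rightarrow> ('g \<Rightarrow> 'x \<Rightarrow> 'x) \<Rightarrow> 'x set" where
  "AP G T X \<phi> = {x \<in> topspace X.
     let Y = X closure_of (Group_Action.orbit G \<phi> x)
     in minimal_flow G T (subtopology X Y) (\<lambda>g. restrict (\<phi> g) Y)}"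

text \<open>A formula of HOL cannot quantify over all types, so CAP carries the type of the points of
  the flows as a parameter. No generality is lost with the type \<open>'g \<Rightarrow> real\<close>, where \<open>'g\<close> is the
  type of the group elements. Indeed, suppose that \<open>x\<close> lies in the closure of the almost periodic
  points of a flow \<open>X\<close> of any size but is not almost periodic itself. Then \<open>x\<close> has an open
  neighborhood \<open>U\<close> for which \<open>{g. g x \<in> U}\<close> is not syndetic. For a continuous \<open>f : X \<rightarrow> [0,1]\<close>
  with \<open>f x = 1\<close> that vanishes off \<open>U\<close>, the image of \<open>X\<close> under \<open>y \<mapsto> (g \<mapsto> f (g y))\<close> is a factor
  of \<open>X\<close> whose points have type \<open>'g \<Rightarrow> real\<close> and whose set of almost periodic points is not
  closed.\<close>

definition CAP :: "'x itself \<Rightarrow> ('g, 'm) monoid_scheme \<Rightarrow> 'g topology \<Rightarrow> bool" where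
  "CAP (_ :: 'x itself) G T \<longleftrightarrow>
     (\<forall>(X :: 'x topology) \<phi>. flow G T X \<phi> \<longrightarrow> closedin X (AP G T X \<phi>))"

end

theory Submission
  imports Defs
begin

text \<open>Let \<open>G\<close> be the automorphism group and, for a finite set \<open>F\<close> of points of \<open>K\<close>, let \<open>H\<close> be
  its pointwise stabilizer. By homogeneity every embedding of \<open>A = K|F\<close> into \<open>K\<close> is the
  restriction to \<open>F\<close> of some \<open>g\<inverse>\<close>, and \<open>g\<close> is determined up to left multiplication by \<open>H\<close>.
  Colorings of the embeddings of \<open>A\<close> into \<open>K\<close> are therefore the left \<open>H\<close>-invariant functions on
  \<open>G\<close>, and finite structures \<open>B\<close> in the age become finite windows \<open>S \<subseteq> G\<close>, whose copies are the
  translates \<open>S g\<close>. That \<open>A\<close> has Ramsey degree at most \<open>k\<close> turns into \<open>few_colors G H k\<close>: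
  whatever the number of colors and the window \<open>S\<close>, some translate \<open>S g\<close> carries at most \<open>k\<close>
  colors (\<open>ramsey_bound_imp_few_colors\<close>, \<open>few_colors_imp_ramsey_bound\<close>; the finite structure \<open>C\<close>
  is obtained from \<open>K\<close> by compactness, \<open>few_colors_finite_window\<close>). Structures disappear at this
  point. It remains to see, for a topological group with a neighborhood basis of open subgroups,
  that all sets of almost periodic points are closed if and only if each of these subgroups has
  few colors for some \<open>k\<close>. Throughout, almost periodicity of \<open>x\<close> is used in the form that \<open>x\<close>
  returns syndetically to each of its neighborhoods (\<open>AP_iff_syndetic\<close>).

  Few colors imply CAP (\<open>closedin_AP\<close>). Let \<open>x\<close> be a limit of almost periodic points \<open>y\<close>, and let
  \<open>f\<close> be a continuous function with \<open>f x = 1\<close> that vanishes off a given neighborhood of \<open>x\<close>. If a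
  single finite \<open>S\<close> witnesses the return of all almost periodic \<open>y\<close> with \<open>f y > 3/4\<close> to the set
  \<open>f \<ge> 1/4\<close>, then it works for the limit \<open>x\<close> as well. If there is no such \<open>S\<close>, one finds points
  \<open>y 0, y 1, \<dots>\<close> and finite windows such that each translate of the \<open>m\<close>-th window contains group
  elements \<open>a i\<close>, \<open>i < m\<close>, for which \<open>f (a i \<cdot> y i)\<close> is large, but \<open>f (a i \<cdot> y j)\<close> is small
  whenever \<open>i < j\<close>. Coloring \<open>g\<close> by the set of those \<open>i \<le> k\<close> for which \<open>f (g \<cdot> y i)\<close> is large,
  one sees at least \<open>k + 1\<close> colors in each translate, which contradicts \<open>few_colors G H k\<close>.

  CAP implies few colors (\<open>few_colors_if_closedin_AP\<close>). If \<open>H\<close> does not have few colors for any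
  \<open>k\<close>, the bad colorings for all \<open>k\<close> can be combined to one function \<open>G \<rightarrow> [0,1]\<close>, and the flow of
  left \<open>H\<close>-invariant functions contains a minimal set \<open>M\<close> whose members have infinite range.
  Hence the values \<open>z \<one>\<close> for \<open>z \<in> M\<close> accumulate at some \<open>c\<close>. Recolor \<open>z \<in> M\<close>, when \<open>z \<one>\<close> is close
  to but different from \<open>c\<close>, by a bump function around \<open>z \<one>\<close> that vanishes near \<open>c\<close> and far away.
  Recolorings of almost periodic points are almost periodic, so any limit \<open>(z, y)\<close> of pairs of a
  coloring and its recoloring, as \<open>z \<one> \<rightarrow> c\<close>, has an almost periodic second component. As
  \<open>y \<one> = 1\<close>, the values of \<open>y\<close> are large at a syndetic set of \<open>g\<close>; but \<open>y g > 1/2\<close> forces the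
  translate of \<open>z\<close> by \<open>g\<close> into the boundary of \<open>{w \<in> M. w \<one> = c}\<close>. A minimal flow is not a finite
  union of translates of a closed nowhere dense set, so this is impossible
  (\<open>minimal_set_finite_range\<close>).\<close>

section \<open>Minimal sets and almost periodic points\<close>

definition minimal_set ::
  "('g, 'm) monoid_scheme \<Rightarrow> 'x topology \<Rightarrow> ('g \<Rightarrow> 'x \<Rightarrow> 'x) \<Rightarrow> 'x set \<Rightarrow> bool" where
  "minimal_set G X \<phi> M \<longleftrightarrow> subflow G X \<phi> M \<and> (\<forall>Y. subflow G X \<phi> Y \<and> Y \<subseteq> M \<longrightarrow> Y = M)"

locale G_flow = group G for G (structure) +
  fixes T :: "'a topology" and X :: "'x topology" and \<phi> :: "'a \<Rightarrow> 'x \<Rightarrow> 'x"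
  assumes topspace_T: "topspace T = carrier G" and flow: "flow G T X \<phi>"
begin

abbreviation orbit_closure :: "'x \<Rightarrow> 'x set" where
  "orbit_closure x \<equiv> Abstract_Topology.closure_of X (Group_Action.orbit G \<phi> x)"

lemma compact: "compact_space X" and Hausdorff: "Hausdorff_space X"
  and action: "group_action G (topspace X) \<phi>"
  and continuous_action: "continuous_map (prod_topology T X) X (\<lambda>(g, x). \<phi> g x)"
  using flow by (auto simp: flow_def)

lemma act_closed: "g \<in> carrier G \<Longrightarrow> x \<in> topspace X \<Longrightarrow> \<phi> g x \<in> topspace X"
  using group_action.element_image[OF action] by blast

lemma act_mult:
  "g \<in> carrier G \<Longrightarrow> h \<in> carrier G \<Longrightarrow> x \<in> topspace X \<Longrightarrow> \<phi> (g \<otimes> h) x = \<phi> g (\<phi> h x)"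
  using group_action.composition_rule[OF action] by blast

lemma act_one: "x \<in> topspace X \<Longrightarrow> \<phi> \<one> x = x"
  using group_action.id_eq_one[OF action] by (metis restrict_apply')

lemma act_inv: "g \<in> carrier G \<Longrightarrow> x \<in> topspace X \<Longrightarrow> \<phi> (inv g) (\<phi> g x) = x"
  by (metis act_mult act_one inv_closed l_inv)

lemma continuous_map_act:
  assumes "g \<in> carrier G"
  shows "continuous_map X X (\<phi> g)"
proof -
  have "continuous_map X (prod_topology T X) (\<lambda>x. (g, x))"
    using assms by (simp add: continuous_map_pairedI topspace_T)
  from continuous_map_compose[OF this continuous_action]
  show ?thesis by (simp add: o_def)
qed

lemma openin_act_preimage:
  "g \<in> carrier G \<Longrightarrow> openin X V \<Longrightarrow> openin X {x \<in> topspace X. \<phi> g x \<in> V}"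
  using openin_continuous_map_preimage[OF continuous_map_act] .

lemma openin_finite_act_preimage:
  assumes "finite S" "S \<subseteq> carrier G" "openin X V"
  shows "openin X {x \<in> topspace X. \<forall>s\<in>S. \<phi> s x \<in> V}"
  using assms
proof (induction S)
  case (insert s S)
  have "{x \<in> topspace X. \<forall>s\<in>insert s S. \<phi> s x \<in> V} =
    {x \<in> topspace X. \<phi> s x \<in> V} \<inter> {x \<in> topspace X. \<forall>s\<in>S. \<phi> s x \<in> V}" by auto
  with insert show ?case by (simp add: openin_act_preimage openin_Int)
qed simp

lemma subflowD:
  assumes "subflow G X \<phi> Y"
  shows "Y \<noteq> {}" "closedin X Y" "Y \<subseteq> topspace X"
    "\<And>g y. g \<in> carrier G \<Longrightarrow> y \<in> Y \<Longrightarrow> \<phi> g y \<in> Y"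
  using assms closedin_subset[of X Y] by (auto simp: subflow_def image_subset_iff)

lemma subflow_orbit_closure:
  assumes "x \<in> topspace X"
  shows "subflow G X \<phi> (orbit_closure x)"
    and "x \<in> orbit_closure x"
proof -
  let ?O = "Group_Action.orbit G \<phi> x"
  have sub: "?O \<subseteq> topspace X"
    using assms act_closed by (auto simp: Group_Action.orbit_def)
  show x: "x \<in> orbit_closure x"
    using closure_of_subset[OF sub] group_action.orbit_refl[OF action assms] by blast
  have "\<phi> g ` (orbit_closure x) \<subseteq> orbit_closure x" if g: "g \<in> carrier G" for g
  proof -
    have "\<phi> g ` ?O \<subseteq> ?O"
    proof
      fix y assume "y \<in> \<phi> g ` ?O"
      then obtain h where h: "h \<in> carrier G" "y = \<phi> g (\<phi> h x)" by (auto simp: Group_Action.orbit_def)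
      then have "y = \<phi> (g \<otimes> h) x" using g assms by (simp add: act_mult)
      with g h show "y \<in> ?O" unfolding Group_Action.orbit_def by blast
    qed
    then show ?thesis
      using continuous_map_image_closure_subset[OF continuous_map_act[OF g], of ?O]
        closure_of_mono by blast
  qed
  with x show "subflow G X \<phi> (orbit_closure x)"
    by (auto simp: subflow_def)
qed

lemma orbit_closure_subset:
  assumes "subflow G X \<phi> Y" "x \<in> Y"
  shows "orbit_closure x \<subseteq> Y"
  using assms by (intro closure_of_minimal) (auto simp: subflow_def Group_Action.orbit_def)

text \<open>The action on an orbit closure has to be restricted to stay extensional. This lemma and the
  next one compare it with the given action, so that minimality can be treated as a property of a
  subset of the given flow.\<close>

lemma flow_restrict:
  assumes Y: "subflow G X \<phi> Y"
  shows "flow G T (subtopology X Y) (\<lambda>g. restrict (\<phi> g) Y)"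
proof -
  note Y' = subflowD[OF Y]
  have bij: "restrict (\<phi> g) Y \<in> Bij Y" if g: "g \<in> carrier G" for g
  proof -
    have "bij_betw (\<phi> g) Y Y"
      using g Y' act_inv[of g] act_inv[of "inv g"]
      by (intro bij_betw_byWitness[where f' = "\<phi> (inv g)"]) auto
    then show ?thesis by (simp add: Bij_def)
  qed
  have "group_action G Y (\<lambda>g. restrict (\<phi> g) Y)"
    unfolding group_action_def group_hom_def group_hom_axioms_def
  proof (intro conjI homI)
    show "group G" by (rule is_group)
    show "group (BijGroup Y)" by (rule group_BijGroup)
  next
    fix g assume "g \<in> carrier G"
    with bij show "restrict (\<phi> g) Y \<in> carrier (BijGroup Y)" by (simp add: BijGroup_def)
  next
    fix g h assume g: "g \<in> carrier G" and h: "h \<in> carrier G"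
    have "restrict (\<phi> (g \<otimes> h)) Y = compose Y (restrict (\<phi> g) Y) (restrict (\<phi> h) Y)"
      using g h Y' by (auto simp: compose_def restrict_def act_mult fun_eq_iff subset_iff)
    then show "restrict (\<phi> (g \<otimes> h)) Y = restrict (\<phi> g) Y \<otimes>\<^bsub>BijGroup Y\<^esub> restrict (\<phi> h) Y"
      using g h bij by (simp add: BijGroup_def)
  qed
  moreover have "continuous_map (prod_topology T (subtopology X Y)) (subtopology X Y)
      (\<lambda>(g, x). restrict (\<phi> g) Y x)"
  proof -
    have "continuous_map (subtopology (prod_topology T X) (topspace T \<times> Y)) X (\<lambda>(g, x). \<phi> g x)"
      by (rule continuous_map_from_subtopology[OF continuous_action])
    then have "continuous_map (prod_topology T (subtopology X Y)) X (\<lambda>(g, x). \<phi> g x)"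
      by (simp add: prod_topology_subtopology(2) subtopology_restrict)
    then have "continuous_map (prod_topology T (subtopology X Y)) (subtopology X Y) (\<lambda>(g, x). \<phi> g x)"
      using Y' by (auto simp: continuous_map_in_subtopology topspace_T)
    then show ?thesis
      by (rule continuous_map_eq) auto
  qed
  ultimately show ?thesis
    using Y' compact Hausdorff
    by (auto simp: flow_def closedin_compact_space compact_space_subtopology Hausdorff_space_subtopology Int_absorb1)
qed

lemma subflow_restrict_iff:
  assumes Y: "subflow G X \<phi> Y"
  shows "subflow G (subtopology X Y) (\<lambda>g. restrict (\<phi> g) Y) Z \<longleftrightarrow> subflow G X \<phi> Z \<and> Z \<subseteq> Y"
proof -
  have "closedin (subtopology X Y) Z \<longleftrightarrow> closedin X Z \<and> Z \<subseteq> Y"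
    by (rule closedin_closed_subtopology) (use subflowD[OF Y] in simp)
  moreover have "restrict (\<phi> g) Y ` Z = \<phi> g ` Z" if "Z \<subseteq> Y" for g
    using that by (intro image_cong) auto
  ultimately show ?thesis
    unfolding subflow_def by metis
qed

lemma AP_iff_minimal_set:
  "x \<in> AP G T X \<phi> \<longleftrightarrow>
    x \<in> topspace X \<and> minimal_set G X \<phi> (orbit_closure x)"
proof (cases "x \<in> topspace X")
  case True
  note Y = subflow_orbit_closure(1)[OF True]
  have "topspace (subtopology X (orbit_closure x))
      = orbit_closure x"
    using subflowD(3)[OF Y] by auto
  then show ?thesis
    using True flow_restrict[OF Y] subflow_restrict_iff[OF Y] Y
    by (auto simp: AP_def Let_def minimal_flow_def minimal_set_def)
qed (simp add: AP_def)

text \<open>The points of \<open>M\<close> whose orbit avoids \<open>V\<close> form a proper closed invariant subset of \<open>M\<close>,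
  which is empty by minimality; so the open sets \<open>{x. \<phi> g x \<in> V}\<close> cover the compact set \<open>M\<close>.\<close>

lemma minimal_set_recurrent:
  assumes M: "minimal_set G X \<phi> M" and V: "openin X V" and VM: "V \<inter> M \<noteq> {}"
  shows "\<exists>S. finite S \<and> S \<subseteq> carrier G \<and> (\<forall>x\<in>M. \<exists>s\<in>S. \<phi> s x \<in> V)"
proof -
  have sM: "subflow G X \<phi> M" using M by (simp add: minimal_set_def)
  note M' = subflowD[OF sM]
  define P where "P g = {x \<in> topspace X. \<phi> g x \<in> V}" for g
  have cov: "M \<subseteq> \<Union>(P ` carrier G)"
  proof (rule ccontr)
    assume ne: "\<not> M \<subseteq> \<Union>(P ` carrier G)"
    let ?Z = "M - \<Union>(P ` carrier G)"
    have "closedin X ?Z"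
      using M' V by (intro closedin_diff openin_Union) (auto simp: P_def openin_act_preimage)
    moreover have "\<phi> g ` ?Z \<subseteq> ?Z" if "g \<in> carrier G" for g
    proof
      fix y assume "y \<in> \<phi> g ` ?Z"
      then obtain z where z: "z \<in> M" "y = \<phi> g z" "\<And>h. h \<in> carrier G \<Longrightarrow> z \<notin> P h" by auto
      have "y \<notin> P h" if "h \<in> carrier G" for h
        using z(3)[of "h \<otimes> g"] that \<open>g \<in> carrier G\<close> z(1,2) M'(3) by (auto simp: P_def act_mult)
      with z M'(4) that show "y \<in> ?Z" by auto
    qed
    ultimately have "subflow G X \<phi> ?Z" using ne by (auto simp: subflow_def)
    then have "?Z = M" using M by (auto simp: minimal_set_def)
    moreover obtain x where x: "x \<in> V" "x \<in> M" using VM by auto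
    moreover have "x \<in> P \<one>" using x M'(3) act_one[of x] by (auto simp: P_def)
    ultimately show False by blast
  qed
  have "compactin X M" using M'(2) compact closedin_compact_space by blast
  moreover have op: "openin X U" if "U \<in> P ` carrier G" for U
    using that V by (auto simp: P_def openin_act_preimage)
  ultimately have "\<exists>F. finite F \<and> F \<subseteq> P ` carrier G \<and> M \<subseteq> \<Union>F"
    by (rule compactinD[OF _ _ cov])
  then obtain F where F: "finite F" "F \<subseteq> P ` carrier G" "M \<subseteq> \<Union>F" by blast
  obtain S where "finite S" "S \<subseteq> carrier G" "F = P ` S"
    using finite_subset_image[OF F(1,2)] by auto
  with F(3) show ?thesis by (intro exI[of _ S]) (auto simp: P_def)
qed

lemma minimal_set_subset_AP:
  assumes M: "minimal_set G X \<phi> M"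
  shows "M \<subseteq> AP G T X \<phi>"
proof
  fix x assume x: "x \<in> M"
  have sM: "subflow G X \<phi> M" using M by (simp add: minimal_set_def)
  have xX: "x \<in> topspace X" using x subflowD(3)[OF sM] by auto
  have "orbit_closure x = M"
    using M subflow_orbit_closure(1)[OF xX] orbit_closure_subset[OF sM x]
    by (simp add: minimal_set_def)
  with M xX show "x \<in> AP G T X \<phi>" by (simp add: AP_iff_minimal_set)
qed

text \<open>For the converse, a subflow of the orbit closure that does not contain \<open>x\<close> is separated
  from \<open>x\<close> by open sets \<open>V\<close> and \<open>W\<close>. Some translate \<open>\<phi> g x\<close> is so close to the subflow that
  \<open>\<phi> (s \<otimes> g) x \<in> W\<close> for the finitely many \<open>s\<close> that should bring it back to \<open>V\<close>.\<close>

proposition AP_iff_syndetic: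
  "x \<in> AP G T X \<phi> \<longleftrightarrow> x \<in> topspace X \<and> (\<forall>V. openin X V \<and> x \<in> V \<longrightarrow>
    (\<exists>S. finite S \<and> S \<subseteq> carrier G \<and> (\<forall>g\<in>carrier G. \<exists>s\<in>S. \<phi> (s \<otimes> g) x \<in> V)))"
  (is "_ \<longleftrightarrow> _ \<and> ?syn")
proof (cases "x \<in> topspace X")
  case x: True
  let ?Y = "orbit_closure x"
  note Y = subflow_orbit_closure[OF x]
  note Y' = subflowD[OF Y(1)]
  have "minimal_set G X \<phi> ?Y \<longleftrightarrow> ?syn"
  proof
    assume M: "minimal_set G X \<phi> ?Y"
    show ?syn
    proof (intro allI impI)
      fix V assume V: "openin X V \<and> x \<in> V"
      then have "V \<inter> ?Y \<noteq> {}" using Y(2) by blast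
      with V obtain S where S: "finite S" "S \<subseteq> carrier G" "\<forall>y\<in>?Y. \<exists>s\<in>S. \<phi> s y \<in> V"
        using minimal_set_recurrent[OF M, of V] by auto
      have "\<exists>s\<in>S. \<phi> (s \<otimes> g) x \<in> V" if g: "g \<in> carrier G" for g
      proof -
        obtain s where s: "s \<in> S" "\<phi> s (\<phi> g x) \<in> V" using S(3) Y'(4)[OF g Y(2)] by blast
        with S(2) g x have "\<phi> (s \<otimes> g) x \<in> V" by (simp add: act_mult subset_iff)
        with s show ?thesis by blast
      qed
      with S show "\<exists>S. finite S \<and> S \<subseteq> carrier G \<and> (\<forall>g\<in>carrier G. \<exists>s\<in>S. \<phi> (s \<otimes> g) x \<in> V)"
        by blast
    qed
  next
    assume syn: ?syn
    have "?Y \<subseteq> Z" if Z: "subflow G X \<phi> Z" and ZY: "Z \<subseteq> ?Y" for Z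
    proof (cases "x \<in> Z")
      case True
      then show ?thesis using orbit_closure_subset[OF Z] by blast
    next
      case False
      note Z' = subflowD[OF Z]
      have "regular_space X" using compact Hausdorff compact_Hausdorff_imp_regular_space by blast
      then obtain V W where VW: "openin X V" "openin X W" "x \<in> V" "Z \<subseteq> W" "disjnt V W"
        using Z'(2) x False unfolding regular_space_def by (meson DiffI)
      obtain S where S: "finite S" "S \<subseteq> carrier G" "\<forall>g\<in>carrier G. \<exists>s\<in>S. \<phi> (s \<otimes> g) x \<in> V"
        using syn[rule_format, OF conjI[OF VW(1,3)]] by blast
      obtain z where z: "z \<in> Z" using Z'(1) by auto
      define W' where "W' = {w \<in> topspace X. \<forall>s\<in>S. \<phi> s w \<in> W}"
      have "openin X W'" unfolding W'_def by (rule openin_finite_act_preimage[OF S(1,2) VW(2)])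
      moreover have "z \<in> W'" using z Z'(3,4) S(2) VW(4) by (simp add: subset_iff W'_def)
      moreover have "z \<in> ?Y" using z ZY by blast
      then have "\<forall>U. z \<in> U \<and> openin X U \<longrightarrow> (\<exists>y. y \<in> Group_Action.orbit G \<phi> x \<and> y \<in> U)"
        by (simp add: in_closure_of)
      ultimately obtain y where y: "y \<in> Group_Action.orbit G \<phi> x" "y \<in> W'" by meson
      then obtain g where g: "g \<in> carrier G" "\<phi> g x \<in> W'"
        by (auto simp: Group_Action.orbit_def)
      obtain s where "s \<in> S" "\<phi> (s \<otimes> g) x \<in> V" using S(3) g(1) by meson
      then have "\<phi> (s \<otimes> g) x \<in> V" "\<phi> (s \<otimes> g) x \<in> W"
        using S(2) x g by (auto simp: W'_def act_mult subset_iff)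
      with VW(5) show ?thesis by (auto simp: disjnt_iff)
    qed
    then show "minimal_set G X \<phi> ?Y" using Y(1) by (auto simp: minimal_set_def)
  qed
  with x show ?thesis by (simp add: AP_iff_minimal_set)
qed (simp add: AP_def)

text \<open>Apply the characterization to the neighborhood \<open>{x. \<phi> h x \<in> V}\<close> of \<open>y\<close>.\<close>

lemma AP_returns:
  assumes y: "y \<in> AP G T X \<phi>" and V: "openin X V" and h: "h \<in> carrier G" "\<phi> h y \<in> V"
  shows "\<exists>S. finite S \<and> S \<subseteq> carrier G \<and> (\<forall>g\<in>carrier G. \<exists>s\<in>S. \<phi> (s \<otimes> g) y \<in> V)"
proof -
  have yX: "y \<in> topspace X" using y AP_iff_syndetic by blast
  have "openin X {x \<in> topspace X. \<phi> h x \<in> V}" "y \<in> {x \<in> topspace X. \<phi> h x \<in> V}"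
    using openin_act_preimage h V yX by auto
  then obtain S where S: "finite S" "S \<subseteq> carrier G"
    "\<forall>g\<in>carrier G. \<exists>s\<in>S. \<phi> (s \<otimes> g) y \<in> {x \<in> topspace X. \<phi> h x \<in> V}"
    using y AP_iff_syndetic by meson
  have "\<exists>s\<in>(\<otimes>) h ` S. \<phi> (s \<otimes> g) y \<in> V" if g: "g \<in> carrier G" for g
  proof -
    obtain s where s: "s \<in> S" "\<phi> h (\<phi> (s \<otimes> g) y) \<in> V" using S g by blast
    moreover have "\<phi> ((h \<otimes> s) \<otimes> g) y = \<phi> h (\<phi> (s \<otimes> g) y)"
      using S(2) s g h yX by (simp add: m_assoc act_mult subset_iff act_closed)
    ultimately have "\<phi> ((h \<otimes> s) \<otimes> g) y \<in> V" by simp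
    with s show ?thesis by blast
  qed
  with S h show ?thesis by (intro exI[of _ "(\<otimes>) h ` S"]) auto
qed

text \<open>Zorn's lemma, formulated for increasing chains, is applied to the complements of subflows;
  the intersection of a chain of subflows is nonempty by compactness.\<close>

lemma exists_minimal_set:
  assumes Y: "subflow G X \<phi> Y"
  shows "\<exists>M\<subseteq>Y. minimal_set G X \<phi> M"
proof -
  define A where "A = (\<lambda>Z. topspace X - Z) ` {Z. subflow G X \<phi> Z \<and> Z \<subseteq> Y}"
  have "\<exists>m\<in>A. \<forall>Z\<in>A. m \<subseteq> Z \<longrightarrow> Z = m"
  proof (rule subset_Zorn_nonempty)
    show "A \<noteq> {}" using Y by (auto simp: A_def)
  next
    fix C assume ne: "C \<noteq> {}" and C: "subset.chain A C"
    then have "C \<subseteq> A" by (simp add: subset.chain_def)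
    then obtain D where D': "D \<subseteq> {Z. subflow G X \<phi> Z \<and> Z \<subseteq> Y}"
      and CD: "C = (\<lambda>Z. topspace X - Z) ` D"
      unfolding A_def by (meson subset_imageE)
    have D: "subflow G X \<phi> Z" "Z \<subseteq> Y" if "Z \<in> D" for Z
      using that D' by auto
    have chain: "Z \<subseteq> Z' \<or> Z' \<subseteq> Z" if "Z \<in> D" "Z' \<in> D" for Z Z'
    proof -
      have "topspace X - Z \<subseteq> topspace X - Z' \<or> topspace X - Z' \<subseteq> topspace X - Z"
        using C that by (auto simp: subset.chain_def CD)
      then show ?thesis
        using subflowD(3)[OF D(1)[OF that(1)]] subflowD(3)[OF D(1)[OF that(2)]] by blast
    qed
    have fin: "\<Inter>F \<in> D" if "finite F" "F \<noteq> {}" "F \<subseteq> D" for F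
      using that
    proof (induction F rule: finite_ne_induct)
      case (insert Z F)
      then show ?case using chain[of Z "\<Inter>F"] by (auto simp: Int_absorb1 Int_absorb2)
    qed auto
    have clo: "closedin X Z" if "Z \<in> D" for Z
      using that D subflowD(2) by simp
    have nonempty_fin: "\<Inter>F \<noteq> {}" if F: "finite F" "F \<subseteq> D" for F
    proof (cases "F = {}")
      case False
      show ?thesis by (rule subflowD(1)[OF D(1)[OF fin[OF F(1) False F(2)]]])
    qed simp
    have "D \<noteq> {}" using ne by (simp add: CD)
    have "\<Inter>D \<noteq> {}"
      using compact[unfolded compact_space_fip, rule_format, of D] clo nonempty_fin by simp
    moreover have "closedin X (\<Inter>D)"
      using \<open>D \<noteq> {}\<close> clo by (intro closedin_Inter) auto
    moreover have "\<phi> g ` \<Inter>D \<subseteq> \<Inter>D" if "g \<in> carrier G" for g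
      using subflowD(4)[OF D(1) that] by auto
    ultimately have "subflow G X \<phi> (\<Inter>D)"
      by (simp add: subflow_def)
    moreover have "\<Inter>D \<subseteq> Y" using D(2) \<open>D \<noteq> {}\<close> by auto
    moreover have "\<Union>C = topspace X - \<Inter>D" using \<open>D \<noteq> {}\<close> by (auto simp: CD)
    ultimately show "\<Union>C \<in> A" by (auto simp: A_def)
  qed
  then obtain M where M: "subflow G X \<phi> M" "M \<subseteq> Y"
    and max: "\<And>Z. subflow G X \<phi> Z \<Longrightarrow> Z \<subseteq> Y \<Longrightarrow> topspace X - M \<subseteq> topspace X - Z
      \<Longrightarrow> topspace X - Z = topspace X - M"
    by (auto simp: A_def)
  have "Z = M" if "subflow G X \<phi> Z" "Z \<subseteq> M" for Z
    using max[of Z] that M(2) subflowD(3)[OF that(1)] subflowD(3)[OF M(1)] by blast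
  with M show ?thesis by (auto simp: minimal_set_def)
qed

end

section \<open>Few colors in some translate of every window\<close>

definition left_invariant :: "('g, 'm) monoid_scheme \<Rightarrow> 'g set \<Rightarrow> ('g \<Rightarrow> 'c) \<Rightarrow> bool" where
  "left_invariant G H \<gamma> \<longleftrightarrow> (\<forall>h\<in>H. \<forall>g\<in>carrier G. \<gamma> (h \<otimes>\<^bsub>G\<^esub> g) = \<gamma> g)"

text \<open>With \<open>H\<close> the pointwise stabilizer of a finite \<open>F\<close>, left \<open>H\<close>-invariant functions are the
  colorings of the embeddings of \<open>K|F\<close> into \<open>K\<close>, and the property says that this structure has
  Ramsey degree at most \<open>k\<close>, with the whole of \<open>K\<close> in place of a finite structure \<open>C\<close>.\<close>

definition few_colors :: "('g, 'm) monoid_scheme \<Rightarrow> 'g set \<Rightarrow> nat \<Rightarrow> bool" where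
  "few_colors G H k \<longleftrightarrow>
     (\<forall>(r::nat) \<gamma> S. finite S \<and> S \<subseteq> carrier G \<and> \<gamma> \<in> carrier G \<rightarrow> {..<r} \<and> left_invariant G H \<gamma> \<longrightarrow>
        (\<exists>g\<in>carrier G. card ((\<lambda>s. \<gamma> (s \<otimes>\<^bsub>G\<^esub> g)) ` S) \<le> k))"

context G_flow begin

text \<open>Suppose that \<open>y\<close> is almost periodic, that \<open>f y\<close> is large, and that \<open>f\<close> is small along some
  translate of the window \<open>S\<close>. Both are open conditions on a point of the orbit of \<open>y\<close>, so they
  recur syndetically. A larger window \<open>S'\<close> therefore sees both in each of its translates: a large
  value, and a copy of \<open>S\<close> with small values only.\<close>

lemma AP_alternating_window:
  assumes f: "continuous_map X euclideanreal f"
    and S: "finite S" "S \<subseteq> carrier G"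
    and y: "y \<in> AP G T X \<phi>" "f y > 3/4"
    and g: "g \<in> carrier G" "\<forall>s\<in>S. f (\<phi> (s \<otimes> g) y) < 1/4"
  shows "\<exists>S'. finite S' \<and> S' \<subseteq> carrier G \<and>
     (\<forall>g\<in>carrier G. (\<exists>t\<in>carrier G. \<forall>s\<in>S. s \<otimes> t \<in> S' \<and> f (\<phi> (s \<otimes> t \<otimes> g) y) < 1/4) \<and>
        (\<exists>t\<in>S'. f (\<phi> (t \<otimes> g) y) > 3/4))"
proof -
  have yX: "y \<in> topspace X" using y by (simp add: AP_def)
  have high: "openin X {w \<in> topspace X. f w \<in> {3/4<..}}" and low: "openin X {w \<in> topspace X. f w \<in> {..<1/4}}"
    by (rule openin_continuous_map_preimage[OF f], simp)+
  define L where "L = {x \<in> topspace X. \<forall>s\<in>S. \<phi> s x \<in> {w \<in> topspace X. f w \<in> {..<1/4}}}"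
  have L: "openin X L"
    unfolding L_def by (rule openin_finite_act_preimage[OF S low])
  have "\<phi> g y \<in> L" using g S yX by (auto simp: L_def act_mult act_closed subset_iff)
  then obtain R where R: "finite R" "R \<subseteq> carrier G" "\<forall>g\<in>carrier G. \<exists>t\<in>R. \<phi> (t \<otimes> g) y \<in> L"
    using AP_returns[OF y(1) L g(1)] by auto
  have "\<phi> \<one> y \<in> {w \<in> topspace X. f w \<in> {3/4<..}}" using y yX by (simp add: act_one)
  then obtain R' where R': "finite R'" "R' \<subseteq> carrier G"
    "\<forall>g\<in>carrier G. \<exists>t\<in>R'. \<phi> (t \<otimes> g) y \<in> {w \<in> topspace X. f w \<in> {3/4<..}}"
    using AP_returns[OF y(1) high one_closed] by auto
  define S' where "S' = R' \<union> (\<lambda>(s, t). s \<otimes> t) ` (S \<times> R)"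
  have "(\<exists>t\<in>carrier G. \<forall>s\<in>S. s \<otimes> t \<in> S' \<and> f (\<phi> (s \<otimes> t \<otimes> g) y) < 1/4) \<and>
        (\<exists>t\<in>S'. f (\<phi> (t \<otimes> g) y) > 3/4)" if g: "g \<in> carrier G" for g
  proof
    obtain t where t: "t \<in> R" "\<phi> (t \<otimes> g) y \<in> L" using R g by auto
    have "s \<otimes> t \<in> S' \<and> f (\<phi> (s \<otimes> t \<otimes> g) y) < 1/4" if s: "s \<in> S" for s
    proof
      show "s \<otimes> t \<in> S'" using s t by (auto simp: S'_def)
      have "s \<in> carrier G" "t \<in> carrier G" using s S t R by auto
      then have "\<phi> (s \<otimes> t \<otimes> g) y = \<phi> s (\<phi> (t \<otimes> g) y)"
        using yX g by (simp add: m_assoc act_mult[of s])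
      then show "f (\<phi> (s \<otimes> t \<otimes> g) y) < 1/4" using t s by (simp add: L_def)
    qed
    then show "\<exists>t\<in>carrier G. \<forall>s\<in>S. s \<otimes> t \<in> S' \<and> f (\<phi> (s \<otimes> t \<otimes> g) y) < 1/4"
      using t(1) R(2) by auto
    show "\<exists>t\<in>S'. f (\<phi> (t \<otimes> g) y) > 3/4"
      using R'(3) g by (force simp: S'_def)
  qed
  moreover have "finite S'" "S' \<subseteq> carrier G"
    using S R R' by (auto simp: S'_def)
  ultimately show ?thesis by auto
qed

text \<open>The core of the implication from few colors to CAP: one finite set of return times serves
  all almost periodic points at once. Otherwise the preceding lemma can be iterated. Along the
  nested copies of the windows one finds elements \<open>a i\<close> such that \<open>f\<close> is large at \<open>a i \<cdot> y i\<close> and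
  small at \<open>a i \<cdot> y j\<close> for \<open>j > i\<close>. Their colors are distinct, so each translate of the last
  window has more than \<open>k\<close> colors.\<close>

lemma few_colors_uniform_returns:
  assumes f: "continuous_map X euclideanreal f"
    and H: "subgroup H G" and few: "few_colors G H k"
    and near: "\<And>h y. h \<in> H \<Longrightarrow> y \<in> topspace X \<Longrightarrow> \<bar>f (\<phi> h y) - f y\<bar> < 1/8"
  shows "\<exists>S. finite S \<and> S \<subseteq> carrier G \<and>
    (\<forall>y\<in>AP G T X \<phi>. f y > 3/4 \<longrightarrow> (\<forall>g\<in>carrier G. \<exists>s\<in>S. f (\<phi> (s \<otimes> g) y) \<ge> 1/4))"
proof (rule ccontr)
  assume neg: "\<not> ?thesis"
  define step where "step S y S' \<longleftrightarrow> y \<in> topspace X \<and> finite S' \<and> S' \<subseteq> carrier G \<and>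
     (\<forall>g\<in>carrier G. (\<exists>t\<in>carrier G. \<forall>s\<in>S. s \<otimes> t \<in> S' \<and> f (\<phi> (s \<otimes> t \<otimes> g) y) < 1/4) \<and>
        (\<exists>t\<in>S'. f (\<phi> (t \<otimes> g) y) > 3/4))" for S y S'
  have "\<exists>y S'. step S y S'" if S: "finite S" "S \<subseteq> carrier G" for S
  proof -
    from neg S obtain y g where y: "y \<in> AP G T X \<phi>" "f y > 3/4"
      and g: "g \<in> carrier G" "\<forall>s\<in>S. f (\<phi> (s \<otimes> g) y) < 1/4"
      by (auto simp: not_le)
    from y have "y \<in> topspace X" by (simp add: AP_def)
    with AP_alternating_window[OF f S y g] show ?thesis unfolding step_def by blast
  qed
  then obtain Y N where step: "\<And>S. finite S \<Longrightarrow> S \<subseteq> carrier G \<Longrightarrow> step S (Y S) (N S)"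
    by metis
  \<comment> \<open>\<open>Sq (Suc i)\<close> absorbs \<open>Sq i\<close>, and along \<open>y i\<close> the function \<open>f\<close> is large somewhere on each
    translate of \<open>Sq (Suc i)\<close> and small on a whole copy of \<open>Sq i\<close> inside it.\<close>
  define Sq where "Sq i = (N ^^ i) {}" for i
  define y where "y i = Y (Sq i)" for i
  have Sq: "finite (Sq i) \<and> Sq i \<subseteq> carrier G" for i
    by (induction i) (use step in \<open>auto simp: Sq_def step_def\<close>)
  have step': "step (Sq i) (y i) (Sq (Suc i))" for i
    using step[of "Sq i"] Sq[of i] by (simp add: y_def Sq_def)
  have yX: "y i \<in> topspace X" for i using step' by (simp add: step_def)
  have pattern: "\<forall>g\<in>carrier G. \<exists>a. (\<forall>i<m. a i \<in> Sq m \<and> f (\<phi> (a i \<otimes> g) (y i)) > 3/4) \<and>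
      (\<forall>i j. i < j \<and> j < m \<longrightarrow> f (\<phi> (a i \<otimes> g) (y j)) < 1/4)" for m
  proof (induction m)
    case (Suc m)
    show ?case
    proof
      fix g assume g: "g \<in> carrier G"
      \<comment> \<open>The elements \<open>a i\<close> with \<open>i < m\<close> are taken in the copy \<open>Sq m \<otimes> t\<close> on which \<open>f\<close> is small
        along \<open>y m\<close>; \<open>t'\<close> is the new element, at which it is large.\<close>
      obtain t where t: "t \<in> carrier G"
        "\<And>s. s \<in> Sq m \<Longrightarrow> s \<otimes> t \<in> Sq (Suc m) \<and> f (\<phi> (s \<otimes> t \<otimes> g) (y m)) < 1/4"
        using step'[of m] g unfolding step_def by meson
      obtain t' where t': "t' \<in> Sq (Suc m)" "f (\<phi> (t' \<otimes> g) (y m)) > 3/4"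
        using step'[of m] g unfolding step_def by meson
      obtain a where a: "\<And>i. i < m \<Longrightarrow> a i \<in> Sq m \<and> f (\<phi> (a i \<otimes> (t \<otimes> g)) (y i)) > 3/4"
        "\<And>i j. i < j \<Longrightarrow> j < m \<Longrightarrow> f (\<phi> (a i \<otimes> (t \<otimes> g)) (y j)) < 1/4"
        using Suc[rule_format, of "t \<otimes> g"] t(1) g by auto
      define b where "b i = (if i = m then t' else a i \<otimes> t)" for i
      have ag: "a i \<otimes> t \<otimes> g = a i \<otimes> (t \<otimes> g)" if "i < m" for i
        using a(1)[OF that] Sq[of m] t(1) g by (auto simp: m_assoc)
      have "b i \<in> Sq (Suc m) \<and> f (\<phi> (b i \<otimes> g) (y i)) > 3/4" if "i < Suc m" for i
        using that a(1)[of i] t(2)[of "a i"] t' ag[of i] by (cases "i = m") (simp_all add: b_def)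
      moreover have "f (\<phi> (b i \<otimes> g) (y j)) < 1/4" if "i < j" "j < Suc m" for i j
        using that a[of i] t(2)[of "a i"] ag[of i] by (cases "j = m") (simp_all add: b_def)
      ultimately show "\<exists>a. (\<forall>i<Suc m. a i \<in> Sq (Suc m) \<and> f (\<phi> (a i \<otimes> g) (y i)) > 3/4) \<and>
        (\<forall>i j. i < j \<and> j < Suc m \<longrightarrow> f (\<phi> (a i \<otimes> g) (y j)) < 1/4)"
        by blast
    qed
  qed auto
  \<comment> \<open>The function \<open>g \<mapsto> f (g y)\<close> is only nearly constant on the cosets \<open>H #> g\<close>; evaluating it at
    a chosen representative makes the coloring exactly invariant. The thresholds
    \<open>1/4 < 1/2 < 3/4\<close> leave room for the error \<open>1/8\<close>.\<close>
  define \<rho> where "\<rho> g = (SOME x. x \<in> H #> g)" for g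
  have \<rho>: "\<rho> g \<in> H #> g" if "g \<in> carrier G" for g
    unfolding \<rho>_def using rcos_self[OF that H] by (rule someI)
  have \<rho>_inv: "\<rho> (h \<otimes> g) = \<rho> g" if "h \<in> H" "g \<in> carrier G" for h g
    using repr_independence[OF _ that(2) H, of "h \<otimes> g"] rcosI[OF that(1) subgroup.subset[OF H] that(2)]
    by (simp add: \<rho>_def)
  have near_\<rho>: "\<bar>f (\<phi> (\<rho> g) (y i)) - f (\<phi> g (y i))\<bar> < 1/8" if g: "g \<in> carrier G" for g i
  proof -
    obtain h where h: "h \<in> H" "\<rho> g = h \<otimes> g" using \<rho>[OF g] by (auto simp: r_coset_def)
    moreover have "h \<in> carrier G" using h subgroup.subset[OF H] by auto
    ultimately show ?thesis
      using near[of h "\<phi> g (y i)"] g yX act_closed by (simp add: act_mult)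
  qed
  define c where "c g = {i. i < Suc k \<and> f (\<phi> (\<rho> g) (y i)) \<ge> 1/2}" for g
  obtain enc where enc: "bij_betw enc (Pow {..<Suc k}) {0..<card (Pow {..<Suc k})}"
    using ex_bij_betw_finite_nat by blast
  have cP: "c g \<in> Pow {..<Suc k}" for g by (auto simp: c_def)
  define \<gamma> where "\<gamma> g = enc (c g)" for g
  have "\<gamma> \<in> carrier G \<rightarrow> {..<card (Pow {..<Suc k})}"
    using bij_betwE[OF enc] cP by (auto simp: \<gamma>_def)
  moreover have "left_invariant G H \<gamma>"
    by (simp add: left_invariant_def \<gamma>_def c_def \<rho>_inv)
  ultimately obtain g where g: "g \<in> carrier G" "card ((\<lambda>s. \<gamma> (s \<otimes> g)) ` Sq (Suc k)) \<le> k"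
    using few Sq[of "Suc k"] unfolding few_colors_def by meson
  obtain a where a: "\<And>i. i < Suc k \<Longrightarrow> a i \<in> Sq (Suc k) \<and> f (\<phi> (a i \<otimes> g) (y i)) > 3/4"
      "\<And>i j. i < j \<Longrightarrow> j < Suc k \<Longrightarrow> f (\<phi> (a i \<otimes> g) (y j)) < 1/4"
    using pattern[of "Suc k", rule_format, OF g(1)] by auto
  have ag: "a i \<otimes> g \<in> carrier G" if "i < Suc k" for i
    using a(1)[OF that] Sq g(1) by blast
  have mem: "i \<in> c (a i \<otimes> g)" if "i < Suc k" for i
  proof -
    have "f (\<phi> (\<rho> (a i \<otimes> g)) (y i)) \<ge> 1/2"
      using a(1)[OF that] near_\<rho>[OF ag[OF that], of i] by linarith
    with that show ?thesis by (simp add: c_def)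
  qed
  have nmem: "j \<notin> c (a i \<otimes> g)" if "i < j" "j < Suc k" for i j
  proof -
    have "f (\<phi> (\<rho> (a i \<otimes> g)) (y j)) < 1/2"
      using a(2)[OF that] near_\<rho>[OF ag, of i j] that by linarith
    then show ?thesis by (simp add: c_def)
  qed
  have "inj_on (\<lambda>i. \<gamma> (a i \<otimes> g)) {..<Suc k}"
  proof (rule linorder_inj_onI)
    fix i j assume ij: "i < j" "i \<in> {..<Suc k}" "j \<in> {..<Suc k}"
    then have "c (a i \<otimes> g) \<noteq> c (a j \<otimes> g)" using mem[of j] nmem[of i j] by auto
    then show "\<gamma> (a i \<otimes> g) \<noteq> \<gamma> (a j \<otimes> g)"
      using cP bij_betw_imp_inj_on[OF enc] by (simp add: \<gamma>_def inj_on_eq_iff)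
  qed auto
  then have "Suc k = card ((\<lambda>i. \<gamma> (a i \<otimes> g)) ` {..<Suc k})" by (simp add: card_image)
  also have "\<dots> \<le> card ((\<lambda>s. \<gamma> (s \<otimes> g)) ` Sq (Suc k))"
    using a(1) Sq[of "Suc k"] by (intro card_mono) auto
  finally show False using g(2) by simp
qed

text \<open>The uniform window found for the almost periodic points near \<open>x\<close> passes to the limit \<open>x\<close>,
  since failing at \<open>x\<close> for a fixed \<open>g\<close> is an open condition that involves finitely many group
  elements.\<close>

theorem closedin_AP:
  assumes basis: "\<And>V. openin T V \<Longrightarrow> \<one> \<in> V \<Longrightarrow> \<exists>H k. subgroup H G \<and> H \<subseteq> V \<and> few_colors G H k"
  shows "closedin X (AP G T X \<phi>)"
proof -
  have "x \<in> AP G T X \<phi>" if x: "x \<in> Abstract_Topology.closure_of X (AP G T X \<phi>)" for x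
  proof -
    have xX: "x \<in> topspace X" using x by (simp add: in_closure_of)
    have "\<exists>S. finite S \<and> S \<subseteq> carrier G \<and> (\<forall>g\<in>carrier G. \<exists>s\<in>S. \<phi> (s \<otimes> g) x \<in> V)"
      if V: "openin X V" "x \<in> V" for V
    proof -
      have "completely_regular_space X"
        using compact Hausdorff by (simp add: compact_Hausdorff_or_regular_imp_normal_space normal_imp_completely_regular_space)
      then obtain f0 :: "'x \<Rightarrow> real" where f0: "continuous_map X euclideanreal f0" "f0 x = 0" "f0 ` (topspace X - V) \<subseteq> {1}"
        using V unfolding completely_regular_space_alt' by meson
      \<comment> \<open>The separation lemma yields the value \<open>0\<close> at the point and \<open>1\<close> off the neighborhood.\<close>
      define f where "f w = 1 - f0 w" for w
      have f: "continuous_map X euclideanreal f"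
        unfolding f_def by (intro continuous_intros f0)
      have fV: "w \<in> V" if "w \<in> topspace X" "f w \<ge> 1/4" for w
        using that f0(3) by (fastforce simp: f_def)
      define W where "W = {p \<in> topspace (prod_topology T X). (f ((\<lambda>(g, x). \<phi> g x) p) - f (snd p)) \<in> {-1/8<..<1/8}}"
      have "openin (prod_topology T X) W"
        unfolding W_def
      proof (rule openin_continuous_map_preimage)
        show "continuous_map (prod_topology T X) euclideanreal
            (\<lambda>p. f ((\<lambda>(g, x). \<phi> g x) p) - f (snd p))"
          by (intro continuous_map_diff continuous_map_compose[OF continuous_action f, unfolded o_def]
            continuous_map_compose[OF continuous_map_snd f, unfolded o_def])
      qed simp
      moreover have "{\<one>} \<times> topspace X \<subseteq> W"
        by (auto simp: W_def topspace_T act_one)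
      \<comment> \<open>By compactness of \<open>X\<close>, elements near \<open>\<one>\<close> change \<open>f\<close> by less than \<open>1/8\<close> at all points at
        once.\<close>
      ultimately obtain U U' where U: "openin T U" "\<one> \<in> U" "topspace X \<subseteq> U'" "U \<times> U' \<subseteq> W"
        using tube_lemma_right[of T X W "topspace X" \<one>] compact topspace_T
        by (auto simp: compact_space_def)
      obtain H k where H: "subgroup H G" "H \<subseteq> U" "few_colors G H k"
        using basis[OF U(1,2)] by auto
      have "\<bar>f (\<phi> h w) - f w\<bar> < 1/8" if "h \<in> H" "w \<in> topspace X" for h w
      proof -
        have "(h, w) \<in> W" using that H(2) U(3,4) by blast
        then have "- 1/8 < f (\<phi> h w) - f w" "f (\<phi> h w) - f w < 1/8" by (simp_all add: W_def)
        then show ?thesis by linarith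
      qed
      from few_colors_uniform_returns[OF f H(1,3) this]
      obtain S where S: "finite S" "S \<subseteq> carrier G"
        and ret: "\<And>y g. y \<in> AP G T X \<phi> \<Longrightarrow> f y > 3/4 \<Longrightarrow> g \<in> carrier G \<Longrightarrow>
          \<exists>s\<in>S. f (\<phi> (s \<otimes> g) y) \<ge> 1/4"
        by auto
      have "\<exists>s\<in>S. f (\<phi> (s \<otimes> g) x) \<ge> 1/4" if g: "g \<in> carrier G" for g
      proof (rule ccontr)
        assume "\<not> ?thesis"
        then have low: "\<forall>s\<in>S. f (\<phi> (s \<otimes> g) x) < 1/4" by auto
        define U where "U = {w \<in> topspace X. \<forall>s\<in>(\<lambda>s. s \<otimes> g) ` S. \<phi> s w \<in> {w \<in> topspace X. f w \<in> {..<1/4}}}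
          \<inter> {w \<in> topspace X. f w \<in> {3/4<..}}"
        have "openin X U"
          unfolding U_def using S g
          by (intro openin_Int openin_finite_act_preimage openin_continuous_map_preimage[OF f]) auto
        moreover have "x \<in> U"
          using low xX g S f0(2) by (auto simp: U_def f_def act_closed)
        ultimately obtain y where "y \<in> AP G T X \<phi>" "y \<in> U"
          using x unfolding in_closure_of by meson
        with ret[of y g] g show False by (force simp: U_def)
      qed
      then have "\<exists>s\<in>S. \<phi> (s \<otimes> g) x \<in> V" if "g \<in> carrier G" for g
        using that fV act_closed xX S(2) by (meson m_closed subsetD)
      with S show ?thesis by auto
    qed
    with xX show ?thesis by (simp add: AP_iff_syndetic)
  qed
  moreover have "AP G T X \<phi> \<subseteq> topspace X" by (auto simp: AP_def)
  ultimately show ?thesis by (metis closure_of_subset_eq subsetI)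
qed

end

section \<open>Nowhere dense sets in minimal flows\<close>

context G_flow begin

text \<open>Being in the translates of \<open>B\<close> under \<open>S\<close> is a closed condition; if it holds along the orbit
  of \<open>z\<close>, it holds on all of \<open>M\<close> by minimality. Then \<open>M\<close> would be a finite union of closed sets
  with empty interior.\<close>

lemma minimal_set_visits_nowhere_dense:
  assumes M: "minimal_set G X \<phi> M" and B: "closedin X B" "B \<subseteq> M"
    and int: "subtopology X M interior_of B = {}"
    and z: "z \<in> M" and S: "finite S" "S \<subseteq> carrier G"
    and visits: "\<And>g. g \<in> carrier G \<Longrightarrow> \<exists>s\<in>S. \<phi> (s \<otimes> g) z \<in> B"
  shows False
proof -
  have sM: "subflow G X \<phi> M" using M by (simp add: minimal_set_def)
  note M' = subflowD[OF sM]
  have topM: "topspace (subtopology X M) = M" using M'(3) by auto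
  define P where "P s = {w \<in> topspace X. \<phi> s w \<in> B}" for s
  have clP: "closedin X (P s)" if "s \<in> carrier G" for s
    unfolding P_def by (rule closedin_continuous_map_preimage[OF continuous_map_act[OF that] B(1)])
  define Q where "Q = \<Union>(P ` S)"
  have clQ: "closedin X Q"
    unfolding Q_def using S clP by (intro closedin_Union) auto
  define W where "W = M \<inter> (\<Inter>g\<in>carrier G. {w \<in> topspace X. \<phi> g w \<in> Q})"
  have "closedin X W"
    unfolding W_def
    by (intro closedin_Int M'(2) closedin_Inter) (auto intro: closedin_continuous_map_preimage[OF continuous_map_act clQ])
  moreover have "\<phi> g ` W \<subseteq> W" if g: "g \<in> carrier G" for g
  proof
    fix y assume "y \<in> \<phi> g ` W"
    then obtain w where w: "w \<in> W" "y = \<phi> g w" by auto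
    have wM: "w \<in> M" "w \<in> topspace X" using w M'(3) by (auto simp: W_def)
    have "\<phi> h y \<in> Q" if h: "h \<in> carrier G" for h
    proof -
      have "\<phi> (h \<otimes> g) w \<in> Q" using w(1) g h by (simp add: W_def)
      then show ?thesis using w g h wM by (simp add: act_mult)
    qed
    moreover have "y \<in> M" using w wM M'(4) g by simp
    ultimately show "y \<in> W" using M'(3) by (auto simp: W_def)
  qed
  moreover have "z \<in> W"
  proof -
    have "\<phi> g z \<in> Q" if g: "g \<in> carrier G" for g
    proof -
      obtain s where s: "s \<in> S" "\<phi> (s \<otimes> g) z \<in> B" using visits[OF g] by auto
      then have "\<phi> s (\<phi> g z) \<in> B" using S g z M'(3) by (auto simp: act_mult subset_iff)
      then show ?thesis using s M'(3) M'(4)[OF g z] by (auto simp: Q_def P_def)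
    qed
    then show ?thesis using z M'(3) by (auto simp: W_def)
  qed
  ultimately have "subflow G X \<phi> W"
    unfolding subflow_def by (intro conjI ballI) auto
  moreover have "W \<subseteq> M" unfolding W_def by (rule Int_lower1)
  ultimately have "W = M"
    using M unfolding minimal_set_def by simp
  have "M \<subseteq> (\<Union>s\<in>S. M \<inter> P s)"
  proof
    fix w assume w: "w \<in> M"
    then have "w \<in> W" using \<open>W = M\<close> by simp
    then have "\<phi> \<one> w \<in> Q" by (simp add: W_def)
    then have "w \<in> Q" using w M'(3) by (simp add: act_one subset_iff)
    with w show "w \<in> (\<Union>s\<in>S. M \<inter> P s)" by (auto simp: Q_def)
  qed
  moreover have "subtopology X M interior_of (\<Union>s\<in>S. M \<inter> P s) = {}"
    using S
  proof (induction S)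
    case (insert s F)
    have s: "s \<in> carrier G" using insert by auto
    have "subtopology X M interior_of (M \<inter> P s) = {}"
    proof (rule ccontr)
      assume "subtopology X M interior_of (M \<inter> P s) \<noteq> {}"
      then obtain V x where V: "openin (subtopology X M) V" "x \<in> V" "V \<subseteq> M \<inter> P s"
        unfolding interior_of_def by auto
      then obtain V' where V': "openin X V'" "V = V' \<inter> M" by (auto simp: openin_subtopology)
      define V'' where "V'' = {w \<in> topspace X. \<phi> (inv s) w \<in> V'} \<inter> M"
      have "openin (subtopology X M) V''"
        unfolding V''_def openin_subtopology using openin_act_preimage[OF _ V'(1), of "inv s"] s by auto
      moreover have "V'' \<subseteq> B"
      proof
        fix w assume w: "w \<in> V''"
        then have "\<phi> (inv s) w \<in> V" using V' M'(4) s by (auto simp: V''_def)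
        then have "\<phi> s (\<phi> (inv s) w) \<in> B" using V(3) by (auto simp: P_def)
        then show "w \<in> B" using act_inv[of "inv s" w] s w by (auto simp: V''_def)
      qed
      moreover have "\<phi> s x \<in> V''"
        using V V' s M'(3,4) by (auto simp: V''_def act_inv)
      ultimately have "\<phi> s x \<in> subtopology X M interior_of B"
        unfolding interior_of_def by blast
      then show False using int by simp
    qed
    moreover have "closedin (subtopology X M) (M \<inter> P s)"
      using clP[OF s] by (auto simp: closedin_subtopology)
    ultimately show ?case
      using insert by (simp add: interior_of_union_eq_empty)
  qed simp
  ultimately have "subtopology X M interior_of M = {}"
    by (metis interior_of_mono subset_empty)
  then show False using z topM by (metis empty_iff interior_of_topspace)
qed

end

section \<open>The flow of invariant colorings\<close>

text \<open>Weights that decrease so fast that two digit sequences (with digits below \<open>r k\<close>) that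
  differ at place \<open>k\<close> have values at distance at least \<open>\<epsilon> k / 2\<close>, uniformly. This merges
  colorings with different finite numbers of colors into one real coloring from which each of
  them can be read off by a closed condition.\<close>

lemma separated_encoding:
  fixes r :: "nat \<Rightarrow> nat"
  shows "\<exists>\<epsilon> :: nat \<Rightarrow> real. (\<forall>k. \<epsilon> k > 0) \<and>
    (\<forall>a. (\<forall>k. a k < r k) \<longrightarrow> (\<Sum>k. real (a k) * \<epsilon> k) \<in> {0..1}) \<and>
    (\<forall>a b k. (\<forall>k. a k < r k) \<longrightarrow> (\<forall>k. b k < r k) \<longrightarrow> a k \<noteq> b k \<longrightarrow>
      \<bar>(\<Sum>k. real (a k) * \<epsilon> k) - (\<Sum>k. real (b k) * \<epsilon> k)\<bar> \<ge> \<epsilon> k / 2)"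
proof -
  define \<epsilon> :: "nat \<Rightarrow> real" where "\<epsilon> k = (\<Prod>j\<le>k. 1 / (4 * (real (r j) + 1)))" for k
  have pos: "\<epsilon> k > 0" for k by (auto simp: \<epsilon>_def intro!: prod_pos)
  have Suc: "\<epsilon> (Suc k) = \<epsilon> k / (4 * (real (r (Suc k)) + 1))" for k by (simp add: \<epsilon>_def)
  have step: "real (r (Suc k)) * \<epsilon> (Suc k) \<le> \<epsilon> k / 4" for k
    using pos[of k] by (simp add: Suc field_simps)
  have quarter: "\<epsilon> (Suc k) \<le> \<epsilon> k / 4" for k
    using pos[of k] by (simp add: Suc field_simps)
  have geo: "\<epsilon> (k + i) \<le> \<epsilon> k * (1/4) ^ i" for k i
  proof (induction i)
    case (Suc i)
    then show ?case using quarter[of "k + i"] by simp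
  qed simp
  have tail: "real (r (Suc k + i)) * \<epsilon> (Suc k + i) \<le> \<epsilon> k / 4 * (1/4) ^ i" for k i
    using step[of "k + i"] geo[of k i] by simp
  have "\<epsilon> 0 \<le> 1/4" by (simp add: \<epsilon>_def field_simps)
  have zero: "real (r 0) * \<epsilon> 0 \<le> 1/4" by (simp add: \<epsilon>_def field_simps)
  have geo_sum: "(\<lambda>i. c * (1/4) ^ i) sums (c * (4/3))" for c :: real
    using sums_mult[OF geometric_sums[of "1/4 :: real"], of c] by simp
  have tail_bound: "summable (\<lambda>i. d (Suc k + i) * \<epsilon> (Suc k + i)) \<and>
      \<bar>\<Sum>i. d (Suc k + i) * \<epsilon> (Suc k + i)\<bar> \<le> \<epsilon> k / 3"
    if d: "\<And>k. \<bar>d k\<bar> \<le> real (r k)" for d :: "nat \<Rightarrow> real" and k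
  proof -
    have le: "norm (d (Suc k + i) * \<epsilon> (Suc k + i)) \<le> \<epsilon> k / 4 * (1/4) ^ i" for i
    proof -
      have "norm (d (Suc k + i) * \<epsilon> (Suc k + i)) \<le> real (r (Suc k + i)) * \<epsilon> (Suc k + i)"
        using mult_right_mono[OF d[of "Suc k + i"], of "\<epsilon> (Suc k + i)"] pos[of "Suc k + i"]
        by (simp add: abs_mult)
      also have "\<dots> \<le> \<epsilon> k / 4 * (1/4) ^ i" by (rule tail)
      finally show ?thesis .
    qed
    note s = geo_sum[of "\<epsilon> k / 4"]
    have "summable (\<lambda>i. d (Suc k + i) * \<epsilon> (Suc k + i))"
      by (rule summable_comparison_test'[OF sums_summable[OF s] le])
    moreover have "norm (\<Sum>i. d (Suc k + i) * \<epsilon> (Suc k + i)) \<le> (\<Sum>i. \<epsilon> k / 4 * (1/4) ^ i)"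
      by (rule norm_suminf_le[OF le sums_summable[OF s]])
    ultimately show ?thesis using sums_unique[OF s] by simp
  qed
  have summ: "summable (\<lambda>i. d i * \<epsilon> i)" if d: "\<And>k. \<bar>d k\<bar> \<le> real (r k)" for d :: "nat \<Rightarrow> real"
    using tail_bound[of d 0, OF d] summable_Suc_iff[of "\<lambda>i. d i * \<epsilon> i"] by simp
  show ?thesis
  proof (intro exI[of _ \<epsilon>] conjI allI impI)
    show "\<epsilon> k > 0" for k by (rule pos)
  next
    fix a assume "\<forall>k. a k < r k"
    then have a: "\<And>k. a k < r k" by blast
    have d: "\<bar>real (a k)\<bar> \<le> real (r k)" for k using a[of k] by simp
    have "real (a 0) * \<epsilon> 0 \<le> real (r 0) * \<epsilon> 0"
      using d[of 0] pos[of 0] by (intro mult_right_mono) auto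
    moreover have "(\<Sum>k. real (a k) * \<epsilon> k) = (\<Sum>k. real (a (Suc 0 + k)) * \<epsilon> (Suc 0 + k)) + real (a 0) * \<epsilon> 0"
      using suminf_split_initial_segment[OF summ[OF d], of 1] by (simp add: add.commute)
    moreover have "(\<Sum>k. real (a k) * \<epsilon> k) \<ge> 0"
      using pos by (intro suminf_nonneg[OF summ[OF d]]) (simp add: less_imp_le)
    ultimately show "(\<Sum>k. real (a k) * \<epsilon> k) \<in> {0..1}"
      using tail_bound[of "\<lambda>k. real (a k)" 0, OF d] zero \<open>\<epsilon> 0 \<le> 1/4\<close> by auto
  next
    fix a b k assume "\<forall>k. a k < r k" "\<forall>k. b k < r k" and ne: "a k \<noteq> b k"
    then have a: "\<And>k. a k < r k" and b: "\<And>k. b k < r k" by blast+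
    define d where "d k = real (a k) - real (b k)" for k
    have d: "\<bar>d k\<bar> \<le> real (r k)" for k using a[of k] b[of k] by (simp add: d_def)
    have da: "\<bar>real (a k)\<bar> \<le> real (r k)" and db: "\<bar>real (b k)\<bar> \<le> real (r k)" for k
      using a[of k] b[of k] by simp_all
    \<comment> \<open>The first place where the sequences differ dominates all later ones, and \<open>\<epsilon> j \<ge> \<epsilon> k\<close>.\<close>
    define j where "j = (LEAST j. a j \<noteq> b j)"
    have j: "a j \<noteq> b j" unfolding j_def by (rule LeastI[of _ k]) (rule ne)
    have jk: "j \<le> k" unfolding j_def using ne by (rule Least_le)
    have less: "d i = 0" if "i < j" for i using that not_less_Least by (fastforce simp: j_def d_def)
    have "\<bar>d j\<bar> \<ge> 1" using j by (simp add: d_def abs_if)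
    then have "\<bar>d j * \<epsilon> j\<bar> \<ge> \<epsilon> j"
      using mult_right_mono[of 1 "\<bar>d j\<bar>" "\<epsilon> j"] pos[of j] by (simp add: abs_mult)
    moreover have "(\<Sum>i. d i * \<epsilon> i) = (\<Sum>i. d (Suc j + i) * \<epsilon> (Suc j + i)) + (\<Sum>i<Suc j. d i * \<epsilon> i)"
      using suminf_split_initial_segment[OF summ[OF d], of "Suc j"] by (simp add: add.commute)
    moreover have "(\<Sum>i<Suc j. d i * \<epsilon> i) = d j * \<epsilon> j" using less by simp
    ultimately have "\<bar>\<Sum>i. d i * \<epsilon> i\<bar> \<ge> \<epsilon> j - \<epsilon> j / 3"
      using tail_bound[of d j, OF d] by linarith
    moreover have "\<epsilon> (Suc n) \<le> \<epsilon> n" for n using quarter[of n] pos[of n] by simp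
    then have "\<epsilon> k \<le> \<epsilon> j" using lift_Suc_antimono_le[of \<epsilon> j k] jk by simp
    moreover have "(\<Sum>i. d i * \<epsilon> i) = (\<Sum>k. real (a k) * \<epsilon> k) - (\<Sum>k. real (b k) * \<epsilon> k)"
      by (subst suminf_diff[OF summ[OF da] summ[OF db]]) (simp add: d_def left_diff_distrib)
    ultimately show "\<bar>(\<Sum>k. real (a k) * \<epsilon> k) - (\<Sum>k. real (b k) * \<epsilon> k)\<bar> \<ge> \<epsilon> k / 2"
      using pos[of j] by linarith
  qed
qed

definition colorings :: "('g, 'm) monoid_scheme \<Rightarrow> 'g set \<Rightarrow> ('g \<Rightarrow> real) topology" where
  "colorings G H = subtopology (product_topology (\<lambda>_. top_of_set {0..1}) (carrier G))
     {z. left_invariant G H z}"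

text \<open>The translate of \<open>z\<close> by \<open>g\<close> is \<open>h \<mapsto> z (h \<otimes> g)\<close>: a left action that respects left
  invariance. It is restricted to the space of colorings because group actions are extensional.\<close>

definition shift ::
  "('g, 'm) monoid_scheme \<Rightarrow> 'g set \<Rightarrow> 'g \<Rightarrow> ('g \<Rightarrow> real) \<Rightarrow> 'g \<Rightarrow> real" where
  "shift G H g = restrict (\<lambda>z. restrict (\<lambda>h. z (h \<otimes>\<^bsub>G\<^esub> g)) (carrier G)) (topspace (colorings G H))"

lemma topspace_colorings:
  "topspace (colorings G H) = {z \<in> carrier G \<rightarrow>\<^sub>E {0..1}. left_invariant G H z}"
  by (auto simp: colorings_def)

text \<open>The last assumption says that all translates of conjugates of \<open>H\<close> are open. It is what
  makes the action jointly continuous: for fixed \<open>h\<close>, an invariant coloring \<open>z\<close> satisfies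
  \<open>z (h \<otimes> g') = z (h \<otimes> g)\<close> for all \<open>g'\<close> near \<open>g\<close>, and the neighborhood does not depend on \<open>z\<close>.\<close>

locale coloring_flow = group G for G (structure) +
  fixes T :: "'a topology" and H :: "'a set"
  assumes topspace_T: "topspace T = carrier G" and subgroup_H: "subgroup H G"
    and openin_coset_preimage:
      "h \<in> carrier G \<Longrightarrow> g \<in> carrier G \<Longrightarrow> openin T {g' \<in> carrier G. h \<otimes> g' \<in> H #> (h \<otimes> g)}"
begin

abbreviation Z where "Z \<equiv> colorings G H"

lemma H_carrier: "h \<in> H \<Longrightarrow> h \<in> carrier G"
  using subgroup.subset[OF subgroup_H] by auto

lemma coloring_cong: "z \<in> topspace Z \<Longrightarrow> g \<in> carrier G \<Longrightarrow> g' \<in> H #> g \<Longrightarrow> z g' = z g"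
  by (auto simp: topspace_colorings left_invariant_def r_coset_def)

lemma continuous_map_eval:
  assumes "g \<in> carrier G"
  shows "continuous_map Z euclideanreal (\<lambda>z. z g)"
proof -
  have "continuous_map Z (top_of_set {0..1::real}) (\<lambda>z. z g)"
    unfolding colorings_def
    by (rule continuous_map_from_subtopology[OF continuous_map_product_projection[OF assms]])
  then show ?thesis by (simp add: continuous_map_in_subtopology)
qed

lemma continuous_map_into_colorings:
  assumes "f ` topspace Y \<subseteq> topspace Z" "\<And>g. g \<in> carrier G \<Longrightarrow> continuous_map Y euclideanreal (\<lambda>y. f y g)"
  shows "continuous_map Y Z f"
proof -
  have 1: "f y \<in> carrier G \<rightarrow>\<^sub>E {0..1}" "left_invariant G H (f y)" if "y \<in> topspace Y" for y
    using assms(1) that unfolding topspace_colorings by auto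
  then have "continuous_map Y (product_topology (\<lambda>_. top_of_set {0..1::real}) (carrier G)) f"
    unfolding continuous_map_componentwise continuous_map_in_subtopology
    using assms(2) by (auto simp: PiE_def Pi_def)
  with 1 show ?thesis
    unfolding colorings_def by (auto simp: continuous_map_in_subtopology)
qed

lemma shift_apply:
  "z \<in> topspace Z \<Longrightarrow> h \<in> carrier G \<Longrightarrow> shift G H g z h = z (h \<otimes> g)"
  by (simp add: shift_def)

lemma shift_closed:
  assumes "g \<in> carrier G" "z \<in> topspace Z"
  shows "shift G H g z \<in> topspace Z"
proof -
  have "shift G H g z = restrict (\<lambda>h. z (h \<otimes> g)) (carrier G)"
    using assms by (simp add: shift_def)
  then show ?thesis
    using assms by (auto simp: topspace_colorings left_invariant_def H_carrier m_assoc PiE_iff)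
qed

lemma coloring_ext:
  assumes "z \<in> topspace Z" "w \<in> topspace Z" "\<And>g. g \<in> carrier G \<Longrightarrow> z g = w g"
  shows "z = w"
  using assms by (intro extensionalityI[of _ "carrier G"]) (auto simp: topspace_colorings PiE_def)

lemma shift_mult:
  assumes "g \<in> carrier G" "h \<in> carrier G" "z \<in> topspace Z"
  shows "shift G H (g \<otimes> h) z = shift G H g (shift G H h z)"
  using assms by (intro coloring_ext) (auto simp: shift_closed shift_apply m_assoc)

lemma shift_one: "z \<in> topspace Z \<Longrightarrow> shift G H \<one> z = z"
  by (intro coloring_ext) (auto simp: shift_closed shift_apply)

lemma Hausdorff_space_colorings: "Hausdorff_space Z"
  unfolding colorings_def
  by (intro Hausdorff_space_subtopology)
    (simp add: Hausdorff_space_product_topology Hausdorff_space_subtopology)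

lemma compact_space_colorings: "compact_space Z"
proof -
  let ?P = "product_topology (\<lambda>_. top_of_set {0..1::real}) (carrier G)"
  have ev: "continuous_map ?P euclideanreal (\<lambda>z. z g)" if "g \<in> carrier G" for g
    using continuous_map_product_projection[OF that, of "\<lambda>_. top_of_set {0..1::real}"]
    by (simp add: continuous_map_in_subtopology)
  define I where "I = topspace ?P \<inter> (\<Inter>h\<in>H. \<Inter>g\<in>carrier G. {z \<in> topspace ?P. z (h \<otimes> g) = z g})"
  have "closedin ?P {z \<in> topspace ?P. z (h \<otimes> g) = z g}" if "h \<in> H" "g \<in> carrier G" for h g
    using that by (intro closedin_continuous_maps_eq[of euclideanreal] ev) (auto simp: H_carrier)
  moreover have "H \<noteq> {}" using subgroup.one_closed[OF subgroup_H] by auto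
  moreover have "carrier G \<noteq> {}" using one_closed by blast
  ultimately have "closedin ?P I"
    unfolding I_def by (intro closedin_Int closedin_Inter closedin_topspace) auto
  moreover have "compact_space ?P"
    by (simp add: compact_space_product_topology compact_space_subtopology)
  ultimately have "compact_space (subtopology ?P I)"
    using closedin_compact_space compact_space_subtopology by blast
  moreover have "subtopology ?P I = Z"
  proof -
    have "I = topspace ?P \<inter> {z. left_invariant G H z}"
      by (auto simp: I_def left_invariant_def)
    then show ?thesis
      unfolding colorings_def by (metis subtopology_restrict)
  qed
  ultimately show ?thesis by simp
qed

lemma shift_Bij: "g \<in> carrier G \<Longrightarrow> shift G H g \<in> Bij (topspace Z)"
proof -
  assume g: "g \<in> carrier G"
  have "bij_betw (shift G H g) (topspace Z) (topspace Z)"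
  proof (rule bij_betw_byWitness[where f' = "shift G H (inv g)"])
    show "\<forall>z\<in>topspace Z. shift G H (inv g) (shift G H g z) = z"
      using g by (simp add: shift_one flip: shift_mult)
    show "\<forall>z\<in>topspace Z. shift G H g (shift G H (inv g) z) = z"
      using g by (simp add: shift_one flip: shift_mult)
    show "shift G H g ` topspace Z \<subseteq> topspace Z" using g shift_closed by blast
    show "shift G H (inv g) ` topspace Z \<subseteq> topspace Z" using g shift_closed inv_closed by blast
  qed
  then show ?thesis by (simp add: Bij_def shift_def)
qed

lemma continuous_map_shift:
  "continuous_map (prod_topology T Z) Z (\<lambda>(g, z). shift G H g z)"
proof (rule continuous_map_into_colorings)
  show "(\<lambda>(g, z). shift G H g z) ` topspace (prod_topology T Z) \<subseteq> topspace Z"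
    by (auto simp: topspace_T shift_closed)
next
  fix h assume h: "h \<in> carrier G"
  show "continuous_map (prod_topology T Z) euclideanreal (\<lambda>y. (case y of (g, z) \<Rightarrow> shift G H g z) h)"
    unfolding continuous_map_def
  proof (intro conjI allI impI)
    fix U :: "real set" assume U: "openin euclidean U"
    let ?A = "{y \<in> topspace (prod_topology T Z). (case y of (g, z) \<Rightarrow> shift G H g z) h \<in> U}"
    show "openin (prod_topology T Z) ?A"
      unfolding openin_prod_topology_alt
    proof (intro allI impI)
      fix g z assume "(g, z) \<in> ?A"
      then have gz: "g \<in> carrier G" "z \<in> topspace Z" "z (h \<otimes> g) \<in> U"
        using h by (auto simp: topspace_T shift_apply)
      let ?V = "{g' \<in> carrier G. h \<otimes> g' \<in> H #> (h \<otimes> g)}"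
      let ?W = "{z \<in> topspace Z. z (h \<otimes> g) \<in> U}"
      have "openin T ?V" using openin_coset_preimage h gz by simp
      moreover have "openin Z ?W"
        using h gz U by (intro openin_continuous_map_preimage[OF continuous_map_eval]) auto
      moreover have "g \<in> ?V" using gz h rcos_self[OF _ subgroup_H, of "h \<otimes> g"] by simp
      moreover have "z \<in> ?W" using gz by simp
      moreover have "?V \<times> ?W \<subseteq> ?A"
      proof
        fix y assume "y \<in> ?V \<times> ?W"
        then obtain g' w where y: "y = (g', w)" and g': "g' \<in> carrier G" "h \<otimes> g' \<in> H #> (h \<otimes> g)"
          and w: "w \<in> topspace Z" "w (h \<otimes> g) \<in> U" by auto
        have "w (h \<otimes> g') = w (h \<otimes> g)"
          using h gz g' w by (intro coloring_cong) auto
        then show "y \<in> ?A"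
          using h w g' by (simp add: y shift_apply topspace_T)
      qed
      ultimately show "\<exists>V W. openin T V \<and> openin Z W \<and> g \<in> V \<and> z \<in> W \<and> V \<times> W \<subseteq> ?A"
        by (intro exI[of _ ?V] exI[of _ ?W]) simp
    qed
  qed simp
qed

lemma flow_colorings: "flow G T Z (shift G H)"
  unfolding flow_def
proof (intro conjI compact_space_colorings Hausdorff_space_colorings continuous_map_shift)
  have "restrict (\<lambda>_. 0) (carrier G) \<in> topspace Z"
    by (auto simp: topspace_colorings left_invariant_def H_carrier)
  then show "topspace Z \<noteq> {}" by blast
  show "group_action G (topspace Z) (shift G H)"
    unfolding group_action_def group_hom_def group_hom_axioms_def
  proof (intro conjI homI is_group group_BijGroup)
    fix g assume g: "g \<in> carrier G"
    then show "shift G H g \<in> carrier (BijGroup (topspace Z))"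
      by (simp add: BijGroup_def shift_Bij)
    fix h assume h: "h \<in> carrier G"
    have "shift G H (g \<otimes> h) = compose (topspace Z) (shift G H g) (shift G H h)"
    proof
      fix z
      show "shift G H (g \<otimes> h) z = compose (topspace Z) (shift G H g) (shift G H h) z"
        using shift_mult[OF g h, of z] by (cases "z \<in> topspace Z") (auto simp: compose_def shift_def)
    qed
    then show "shift G H (g \<otimes> h) = shift G H g \<otimes>\<^bsub>BijGroup (topspace Z)\<^esub> shift G H h"
      using g h shift_Bij by (simp add: BijGroup_def)
  qed
qed

sublocale G_flow G T Z "shift G H"
  by unfold_locales (fact topspace_T flow_colorings)+

end

section \<open>Closed sets of almost periodic colorings\<close>

context coloring_flow begin

abbreviation AP_colorings where "AP_colorings \<equiv> AP G T Z (shift G H)"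

definition recolor :: "(real \<Rightarrow> real) \<Rightarrow> ('a \<Rightarrow> real) \<Rightarrow> 'a \<Rightarrow> real" where
  "recolor f z = restrict (\<lambda>g. f (z g)) (carrier G)"

lemma coloring_range: "z \<in> topspace Z \<Longrightarrow> g \<in> carrier G \<Longrightarrow> z g \<in> {0..1}"
  by (auto simp: topspace_colorings PiE_def Pi_def)

lemma recolor_closed:
  assumes f: "\<And>t. f t \<in> {0..1}" and z: "z \<in> topspace Z"
  shows "recolor f z \<in> topspace Z"
  using assms by (auto simp: recolor_def topspace_colorings left_invariant_def H_carrier)

lemma shift_recolor:
  assumes f: "\<And>t. f t \<in> {0..1}" and z: "z \<in> topspace Z" and g: "g \<in> carrier G"
  shows "shift G H g (recolor f z) = recolor f (shift G H g z)"
proof (rule coloring_ext)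
  show "shift G H g (recolor f z) \<in> topspace Z" "recolor f (shift G H g z) \<in> topspace Z"
    by (intro shift_closed recolor_closed assms)+
  fix h assume h: "h \<in> carrier G"
  show "shift G H g (recolor f z) h = recolor f (shift G H g z) h"
    using h g shift_apply[OF recolor_closed[OF f z] h, of g] shift_apply[OF z h, of g]
    by (simp add: recolor_def)
qed

lemma continuous_map_recolor:
  assumes f: "\<And>t. f t \<in> {0..1}" "continuous_on UNIV f"
  shows "continuous_map Z Z (recolor f)"
proof (rule continuous_map_into_colorings)
  show "recolor f ` topspace Z \<subseteq> topspace Z" using recolor_closed[OF f(1)] by auto
  fix g assume g: "g \<in> carrier G"
  have "continuous_map Z euclideanreal (f \<circ> (\<lambda>z. z g))"
    using continuous_map_eval[OF g] f(2) by (intro continuous_map_compose) auto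
  then show "continuous_map Z euclideanreal (\<lambda>z. recolor f z g)"
    using g by (simp add: recolor_def o_def)
qed

text \<open>Recoloring is a continuous equivariant map, and such maps preserve almost periodicity.\<close>

lemma recolor_AP:
  assumes f: "\<And>t. f t \<in> {0..1}" "continuous_on UNIV f" and z: "z \<in> AP_colorings"
  shows "recolor f z \<in> AP_colorings"
proof -
  have zZ: "z \<in> topspace Z" using z by (simp add: AP_def)
  have "\<exists>S. finite S \<and> S \<subseteq> carrier G \<and> (\<forall>g\<in>carrier G. \<exists>s\<in>S. shift G H (s \<otimes> g) (recolor f z) \<in> V)"
    if V: "openin Z V" "recolor f z \<in> V" for V
  proof -
    let ?V = "{w \<in> topspace Z. recolor f w \<in> V}"
    have "openin Z ?V" "z \<in> ?V"
      using openin_continuous_map_preimage[OF continuous_map_recolor[OF f] V(1)] zZ V by auto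
    then obtain S where S: "finite S" "S \<subseteq> carrier G"
      "\<forall>g\<in>carrier G. \<exists>s\<in>S. shift G H (s \<otimes> g) z \<in> ?V"
      using z AP_iff_syndetic[of z] by meson
    have "\<forall>g\<in>carrier G. \<exists>s\<in>S. shift G H (s \<otimes> g) (recolor f z) \<in> V"
    proof
      fix g assume g: "g \<in> carrier G"
      obtain s where "s \<in> S" "recolor f (shift G H (s \<otimes> g) z) \<in> V" using S(3) g by auto
      moreover have "s \<otimes> g \<in> carrier G" using \<open>s \<in> S\<close> S(2) g by auto
      ultimately show "\<exists>s\<in>S. shift G H (s \<otimes> g) (recolor f z) \<in> V"
        by (intro bexI[of _ s]) (simp_all add: shift_recolor[OF f(1) zZ])
    qed
    with S(1,2) have "finite S \<and> S \<subseteq> carrier G \<and>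
        (\<forall>g\<in>carrier G. \<exists>s\<in>S. shift G H (s \<otimes> g) (recolor f z) \<in> V)"
      by (intro conjI)
    then show ?thesis by (rule exI)
  qed
  then show ?thesis
    using recolor_closed[OF f(1) zZ] by (subst AP_iff_syndetic) simp
qed

text \<open>The tent of height 1 around \<open>b\<close> whose support ends half way between \<open>b\<close> and \<open>c\<close>. For
  \<open>b = c\<close> division by zero makes it the constant 1, so that it is continuous for all parameters.\<close>

definition bump :: "real \<Rightarrow> real \<Rightarrow> real \<Rightarrow> real" where
  "bump c b t = max 0 (1 - 2 * \<bar>t - b\<bar> / \<bar>b - c\<bar>)"

lemma bump_range: "bump c b t \<in> {0..1}"
proof -
  have "0 \<le> 2 * \<bar>t - b\<bar> / \<bar>b - c\<bar>" by simp
  then show ?thesis unfolding bump_def by simp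
qed

lemma continuous_on_bump: "continuous_on UNIV (bump c b)"
  unfolding bump_def by (cases "b = c") (auto intro!: continuous_intros)

lemma bump_self: "bump c b b = 1"
  by (simp add: bump_def)

lemma bump_pos:
  assumes "b \<noteq> c" "bump c b t > 0"
  shows "t \<noteq> c" "\<bar>t - c\<bar> < 2 * \<bar>b - c\<bar>"
proof -
  have "2 * \<bar>t - b\<bar> / \<bar>b - c\<bar> < 1" using assms(2) by (auto simp: bump_def split: if_splits)
  then have "2 * \<bar>t - b\<bar> < \<bar>b - c\<bar>" using assms(1) by (simp add: field_simps)
  then show "\<bar>t - c\<bar> < 2 * \<bar>b - c\<bar>" by (smt (verit))
  show "t \<noteq> c" using \<open>2 * \<bar>t - b\<bar> < \<bar>b - c\<bar>\<close> by (auto simp: abs_minus_commute[of b])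
qed

text \<open>Suppose that the colors \<open>z \<one>\<close> accumulate at \<open>c\<close>. As \<open>w \<in> M\<close> varies with \<open>w \<one> \<rightarrow> c\<close> and
  \<open>w \<one> \<noteq> c\<close>, the tents around \<open>w \<one>\<close> shrink towards \<open>c\<close> without ever containing it. In a limit
  \<open>(z, y)\<close> of the pairs of \<open>w\<close> and its recoloring, a large value \<open>y x\<close> means that \<open>w x\<close> is close
  to but different from \<open>c\<close> for colorings \<open>w \<in> M\<close> arbitrarily near \<open>z\<close>. Hence the translate of
  \<open>z\<close> by \<open>x\<close> takes the value \<open>c\<close> at \<open>\<one>\<close> but is not interior to the set of colorings in \<open>M\<close> that
  do so. Closedness of the set of almost periodic points makes \<open>y\<close> almost periodic, and so this
  boundary is visited syndetically, although it is nowhere dense.\<close>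

proposition minimal_set_finite_range:
  assumes closed: "closedin Z AP_colorings" and M: "minimal_set G Z (shift G H) M"
  shows "finite ((\<lambda>z. z \<one>) ` M)"
proof (rule ccontr)
  assume inf: "infinite ((\<lambda>z. z \<one>) ` M)"
  have sM: "subflow G Z (shift G H) M" using M by (simp add: minimal_set_def)
  note M' = subflowD[OF sM]
  have MAP: "M \<subseteq> AP_colorings" by (rule minimal_set_subset_AP[OF M])
  have "(\<lambda>z. z \<one>) ` M \<subseteq> {0..1}" using M'(3) coloring_range by blast
  then obtain c where c: "c islimpt ((\<lambda>z. z \<one>) ` M)"
    using inf compact_Icc[of "0::real" 1] unfolding compact_eq_Bolzano_Weierstrass by meson
  \<comment> \<open>The pairs are kept together, because the limit has to remember which colorings in \<open>M\<close>
    produced the recolorings.\<close>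
  define A where "A r = {(z, recolor (bump c (z \<one>)) z) | z. z \<in> M \<and> z \<one> \<noteq> c \<and> \<bar>z \<one> - c\<bar> < r}" for r
  define P where "P = prod_topology Z Z"
  have A_top: "A r \<subseteq> topspace P" for r
    using M'(3) recolor_closed[OF bump_range] by (auto simp: A_def P_def)
  have "(\<Inter>n. Abstract_Topology.closure_of P (A (1 / real (Suc n)))) \<noteq> {}"
  proof (rule compact_space_imp_nest)
    show "compact_space P" by (simp add: P_def compact_space_prod_topology compact_space_colorings)
    show "closedin P (Abstract_Topology.closure_of P (A (1 / real (Suc n))))" for n by simp
    show "Abstract_Topology.closure_of P (A (1 / real (Suc n))) \<noteq> {}" for n
    proof -
      obtain b where "b \<in> (\<lambda>z. z \<one>) ` M" "b \<noteq> c" "dist b c < 1 / real (Suc n)"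
        using c unfolding islimpt_approachable by (metis of_nat_0_less_iff zero_less_Suc zero_less_divide_1_iff)
      then have "A (1 / real (Suc n)) \<noteq> {}" by (auto simp: A_def dist_real_def)
      then show ?thesis using closure_of_subset[OF A_top] by blast
    qed
    show "decseq (\<lambda>n. Abstract_Topology.closure_of P (A (1 / real (Suc n))))"
    proof (rule decseq_SucI, rule closure_of_mono)
      fix n :: nat
      have "1 / real (Suc (Suc n)) \<le> 1 / real (Suc n)" by (simp add: field_simps)
      then show "A (1 / real (Suc (Suc n))) \<subseteq> A (1 / real (Suc n))" by (force simp: A_def)
    qed
  qed
  then obtain z y where zy: "\<And>n. (z, y) \<in> Abstract_Topology.closure_of P (A (1 / real (Suc n)))" by fastforce
  have approx: "\<exists>w\<in>M. w \<one> \<noteq> c \<and> \<bar>w \<one> - c\<bar> < r \<and> w \<in> V \<and> recolor (bump c (w \<one>)) w \<in> W"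
    if "r > 0" "openin Z V" "openin Z W" "z \<in> V" "y \<in> W" for r V W
  proof -
    obtain n where n: "1 / real (Suc n) < r" using \<open>r > 0\<close> nat_approx_posE by blast
    have "openin P (V \<times> W)" using that by (simp add: P_def openin_prod_Times_iff)
    moreover have "(z, y) \<in> V \<times> W" using that by simp
    ultimately obtain p where "p \<in> A (1 / real (Suc n))" "p \<in> V \<times> W"
      using zy[of n] unfolding in_closure_of by meson
    then show ?thesis using n by (force simp: A_def)
  qed
  have zyZ: "z \<in> topspace Z" "y \<in> topspace Z"
    using zy[of 0] by (auto simp: in_closure_of P_def)
  have zM: "z \<in> M"
  proof (rule ccontr)
    assume "z \<notin> M"
    then have "openin Z (topspace Z - M)" "z \<in> topspace Z - M" using M'(2) zyZ by auto
    with approx[of 1 "topspace Z - M" "topspace Z"] zyZ show False by auto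
  qed
  have "y \<in> AP_colorings"
  proof (rule ccontr)
    assume "y \<notin> AP_colorings"
    then have "openin Z (topspace Z - AP_colorings)" "y \<in> topspace Z - AP_colorings" using closed zyZ by auto
    then obtain w where "w \<in> M" "recolor (bump c (w \<one>)) w \<in> topspace Z - AP_colorings"
      using approx[of 1 "topspace Z" "topspace Z - AP_colorings"] zyZ by auto
    moreover have "recolor (bump c (w \<one>)) w \<in> AP_colorings"
      using \<open>w \<in> M\<close> MAP by (intro recolor_AP bump_range continuous_on_bump) auto
    ultimately show False by simp
  qed
  have half: "openin Z {w \<in> topspace Z. w g \<in> {1/2<..}}" if "g \<in> carrier G" for g
    by (rule openin_continuous_map_preimage[OF continuous_map_eval[OF that]]) simp
  have y1: "y \<one> > 1/2"
  proof (rule ccontr)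
    assume not: "\<not> y \<one> > 1/2"
    have "openin Z {w \<in> topspace Z. w \<one> \<in> {..<1}}"
      by (rule openin_continuous_map_preimage[OF continuous_map_eval]) simp_all
    then obtain w where "w \<in> M" "recolor (bump c (w \<one>)) w \<one> < 1"
      using approx[of 1 "topspace Z" "{w \<in> topspace Z. w \<one> \<in> {..<1}}"] zyZ not by auto
    then show False by (simp add: recolor_def bump_self)
  qed
  then have "y \<in> {w \<in> topspace Z. w \<one> \<in> {1/2<..}}" using zyZ by simp
  then obtain S where S: "finite S" "S \<subseteq> carrier G"
    and ret: "\<And>g. g \<in> carrier G \<Longrightarrow> \<exists>s\<in>S. shift G H (s \<otimes> g) y \<in> {w \<in> topspace Z. w \<one> \<in> {1/2<..}}"
    using \<open>y \<in> AP_colorings\<close> half[OF one_closed] AP_iff_syndetic[of y] by meson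
  \<comment> \<open>\<open>B\<close> is the boundary, relative to \<open>M\<close>, of the closed set \<open>N\<close>.\<close>
  define N where "N = {w \<in> M. w \<one> = c}"
  define ZM where "ZM = subtopology Z M"
  define B where "B = N - ZM interior_of N"
  have clN: "closedin Z N"
  proof -
    have "closedin Z {w \<in> topspace Z. w \<one> \<in> {c}}"
      by (rule closedin_continuous_map_preimage[OF continuous_map_eval]) auto
    then have "closedin Z (M \<inter> {w \<in> topspace Z. w \<one> \<in> {c}})" using M'(2) by (rule closedin_Int[rotated])
    moreover have "M \<inter> {w \<in> topspace Z. w \<one> \<in> {c}} = N" using M'(3) by (auto simp: N_def)
    ultimately show ?thesis by simp
  qed
  have clNM: "closedin ZM N"
    using clN by (auto simp: ZM_def N_def closedin_subtopology)
  have "closedin ZM B" unfolding B_def by (intro closedin_diff clNM openin_interior_of)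
  then have clB: "closedin Z B" using M'(2) by (simp add: ZM_def closedin_closed_subtopology)
  have intB: "ZM interior_of B = {}"
  proof -
    have "ZM interior_of B \<subseteq> ZM interior_of N" unfolding B_def by (rule interior_of_mono) auto
    moreover have "ZM interior_of B \<subseteq> B" by (rule interior_of_subset)
    ultimately show ?thesis unfolding B_def by blast
  qed
  have "\<exists>s\<in>S. shift G H (s \<otimes> g) z \<in> B" if g: "g \<in> carrier G" for g
  proof -
    obtain s where s: "s \<in> S" "shift G H (s \<otimes> g) y \<in> {w \<in> topspace Z. w \<one> \<in> {1/2<..}}"
      using ret[OF g] by auto
    define x where "x = s \<otimes> g"
    have x: "x \<in> carrier G" using s S g by (auto simp: x_def)
    have yx: "y x > 1/2" using s(2) x zyZ by (simp add: x_def shift_apply)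
    let ?W = "{w \<in> topspace Z. w x \<in> {1/2<..}}"
    have W: "openin Z ?W" "y \<in> ?W" using half[OF x] yx zyZ by auto
    have bumped: "w x \<noteq> c \<and> \<bar>w x - c\<bar> < 2 * r"
      if "w \<in> M" "w \<one> \<noteq> c" "\<bar>w \<one> - c\<bar> < r" "recolor (bump c (w \<one>)) w \<in> ?W" for w r
    proof -
      have "bump c (w \<one>) (w x) > 0" using that(4) x by (simp add: recolor_def)
      note b = bump_pos[OF that(2) this]
      have "2 * \<bar>w \<one> - c\<bar> < 2 * r" using that(3) by simp
      with b show ?thesis using less_trans by blast
    qed
    have "z x = c"
    proof (rule ccontr)
      assume ne: "z x \<noteq> c"
      define \<eta> where "\<eta> = \<bar>z x - c\<bar>"
      have \<eta>: "\<eta> > 0" using ne by (simp add: \<eta>_def)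
      let ?V = "{w \<in> topspace Z. w x \<in> ball (z x) (\<eta>/2)}"
      have "openin Z ?V" by (rule openin_continuous_map_preimage[OF continuous_map_eval[OF x]]) simp
      moreover have "z \<in> ?V" using zyZ \<eta> by simp
      ultimately obtain w where w: "w \<in> M" "w \<one> \<noteq> c" "\<bar>w \<one> - c\<bar> < \<eta>/4" "w \<in> ?V" "recolor (bump c (w \<one>)) w \<in> ?W"
        using approx[of "\<eta>/4" ?V ?W] W \<eta> by auto
      have "\<bar>w x - c\<bar> < 2 * (\<eta>/4)" using bumped[OF w(1,2,3,5)] by simp
      moreover have "\<bar>z x - w x\<bar> < \<eta>/2" using w(4) by (simp add: dist_real_def)
      moreover have "\<eta> \<le> \<bar>z x - w x\<bar> + \<bar>w x - c\<bar>"
        using abs_triangle_ineq[of "z x - w x" "w x - c"] by (simp add: \<eta>_def)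
      ultimately show False by simp
    qed
    have xz: "shift G H x z \<in> M" using M'(4)[OF x zM] .
    have "shift G H x z \<in> N" using xz \<open>z x = c\<close> zyZ x by (simp add: N_def shift_apply)
    moreover have "shift G H x z \<notin> ZM interior_of N"
    proof
      assume "shift G H x z \<in> ZM interior_of N"
      then obtain V where V: "openin ZM V" "shift G H x z \<in> V" "V \<subseteq> N"
        unfolding interior_of_def by blast
      obtain V' where V': "openin Z V'" "V = V' \<inter> M"
        using V(1) unfolding ZM_def openin_subtopology by blast
      let ?V = "{w \<in> topspace Z. shift G H x w \<in> V'}"
      have "openin Z ?V" by (rule openin_act_preimage[OF x V'(1)])
      moreover have "z \<in> ?V" using V V' zyZ by auto
      ultimately obtain w where w: "w \<in> M" "w \<one> \<noteq> c" "\<bar>w \<one> - c\<bar> < 1" "w \<in> ?V" "recolor (bump c (w \<one>)) w \<in> ?W"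
        using approx[of 1 ?V ?W] W by auto
      have "shift G H x w \<in> N" using w V V' M'(4)[OF x w(1)] by auto
      then have "w x = c" using w(4) x by (simp add: N_def shift_apply)
      with bumped[OF w(1,2,3,5)] show False by simp
    qed
    ultimately show ?thesis using s(1) by (auto simp: B_def x_def)
  qed
  then show False
    using minimal_set_visits_nowhere_dense[OF M clB _ _ zM S] intB by (auto simp: B_def N_def ZM_def)
qed

text \<open>For each \<open>k\<close> there are a coloring \<open>\<gamma> k\<close> and a window \<open>S k\<close> all of whose translates carry
  more than \<open>k\<close> colors. The encoding \<open>u\<close> of all \<open>\<gamma> k\<close> belongs to the closed invariant set \<open>Q\<close> of
  the colorings that take, on each translate of \<open>S k\<close>, more than \<open>k\<close> values at mutual distance at
  least \<open>\<epsilon> k / 2\<close>. A minimal set inside \<open>Q\<close> has infinite range.\<close>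

theorem few_colors_if_closedin_AP:
  assumes closed: "closedin Z AP_colorings"
  shows "\<exists>k. few_colors G H k"
proof (rule ccontr)
  assume "\<nexists>k. few_colors G H k"
  then have "\<forall>k. \<exists>r \<gamma> S. finite S \<and> S \<subseteq> carrier G \<and> \<gamma> \<in> carrier G \<rightarrow> {..<r::nat} \<and> left_invariant G H \<gamma> \<and>
      (\<forall>g\<in>carrier G. k < card ((\<lambda>s. \<gamma> (s \<otimes> g)) ` S))"
    unfolding few_colors_def not_ex not_all not_imp by (simp add: not_le)
  then obtain r :: "nat \<Rightarrow> nat" and \<gamma> S where
    S: "\<And>k. finite (S k)" "\<And>k. S k \<subseteq> carrier G"
    and \<gamma>: "\<And>k. \<gamma> k \<in> carrier G \<rightarrow> {..<r k}" "\<And>k. left_invariant G H (\<gamma> k)"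
    and many: "\<And>k g. g \<in> carrier G \<Longrightarrow> k < card ((\<lambda>s. \<gamma> k (s \<otimes> g)) ` S k)"
    by metis
  obtain \<epsilon> :: "nat \<Rightarrow> real" where \<epsilon>: "\<forall>k. \<epsilon> k > 0"
    and enc: "\<forall>a. (\<forall>k. a k < r k) \<longrightarrow> (\<Sum>k. real (a k) * \<epsilon> k) \<in> {0..1}"
    and sep: "\<forall>a b k. (\<forall>k. a k < r k) \<longrightarrow> (\<forall>k. b k < r k) \<longrightarrow> a k \<noteq> b k \<longrightarrow>
      \<bar>(\<Sum>k. real (a k) * \<epsilon> k) - (\<Sum>k. real (b k) * \<epsilon> k)\<bar> \<ge> \<epsilon> k / 2"
    using separated_encoding[of r] by (elim exE conjE) (rule that)
  define u where "u = restrict (\<lambda>g. \<Sum>k. real (\<gamma> k g) * \<epsilon> k) (carrier G)"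
  have \<gamma>_less: "\<gamma> k g < r k" if "g \<in> carrier G" for k g
    using \<gamma>(1)[of k] that by auto
  have uZ: "u \<in> topspace Z"
    using enc[rule_format, OF \<gamma>_less] \<gamma>(2) by (auto simp: u_def topspace_colorings left_invariant_def H_carrier)
  \<comment> \<open>A uniform gap between the values, rather than mere distinctness, makes the condition closed.\<close>
  define E where "E k g D = {z \<in> topspace Z. \<forall>s\<in>D. \<forall>t\<in>D. s \<noteq> t \<longrightarrow> \<bar>z (s \<otimes> g) - z (t \<otimes> g)\<bar> \<ge> \<epsilon> k / 2}" for k g D
  define \<D> where "\<D> k = {D. D \<subseteq> S k \<and> k < card D}" for k
  define Q where "Q = topspace Z \<inter> (\<Inter>k. \<Inter>g\<in>carrier G. \<Union>D\<in>\<D> k. E k g D)"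
  have clE: "closedin Z (E k g D)" if "g \<in> carrier G" "D \<in> \<D> k" for k g D
  proof -
    have D: "D \<subseteq> carrier G" using that S(2)[of k] by (auto simp: \<D>_def)
    have "closedin Z {z \<in> topspace Z. \<bar>z (s \<otimes> g) - z (t \<otimes> g)\<bar> \<in> {\<epsilon> k / 2..}}" if "s \<in> D" "t \<in> D" for s t
      using D that \<open>g \<in> carrier G\<close>
      by (intro closedin_continuous_map_preimage[where Y = euclideanreal] continuous_map_real_abs continuous_map_diff continuous_map_eval) auto
    moreover have "finite D" using that S(1)[of k] finite_subset unfolding \<D>_def by blast
    moreover have "E k g D = topspace Z - (\<Union>(s, t)\<in>{(s, t) \<in> D \<times> D. s \<noteq> t}.
        topspace Z - {z \<in> topspace Z. \<bar>z (s \<otimes> g) - z (t \<otimes> g)\<bar> \<in> {\<epsilon> k / 2..}})"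
      by (auto simp: E_def)
    ultimately show ?thesis
      by (auto intro!: closedin_diff openin_Union)
  qed
  have "subflow G Z (shift G H) Q"
    unfolding subflow_def
  proof (intro conjI ballI)
    have "u \<in> Q"
      unfolding Q_def
    proof (intro IntI INT_I uZ)
      fix k g assume g: "g \<in> carrier G"
      define f where "f s = \<gamma> k (s \<otimes> g)" for s
      have "f ` S k \<subseteq> f ` S k" by (rule order_refl)
      then have "\<exists>D. D \<subseteq> S k \<and> inj_on f D \<and> f ` S k = f ` D"
        unfolding subset_image_inj .
      then obtain D where D: "D \<subseteq> S k" "inj_on f D" "f ` S k = f ` D"
        by (elim exE conjE) (rule that)
      have "card D > k" using many[OF g, of k] card_image[OF D(2)] D(3) by (simp add: f_def)
      moreover have "u \<in> E k g D"
      proof -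
        have "\<bar>u (s \<otimes> g) - u (t \<otimes> g)\<bar> \<ge> \<epsilon> k / 2" if "s \<in> D" "t \<in> D" "s \<noteq> t" for s t
        proof -
          have st: "s \<otimes> g \<in> carrier G" "t \<otimes> g \<in> carrier G" using that D S(2)[of k] g by auto
          have "\<gamma> k (s \<otimes> g) \<noteq> \<gamma> k (t \<otimes> g)" using D(2) that unfolding inj_on_def f_def by blast
          from sep[rule_format, of "\<lambda>k. \<gamma> k (s \<otimes> g)" "\<lambda>k. \<gamma> k (t \<otimes> g)", OF \<gamma>_less[OF st(1)] \<gamma>_less[OF st(2)] this]
          show ?thesis using st by (simp add: u_def)
        qed
        then show ?thesis using uZ by (simp add: E_def)
      qed
      ultimately show "u \<in> (\<Union>D\<in>\<D> k. E k g D)" using D(1) by (auto simp: \<D>_def)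
    qed
    then show "Q \<noteq> {}" by blast
    have "closedin Z (\<Union>D\<in>\<D> k. E k g D)" if "g \<in> carrier G" for k g
      using S(1)[of k] clE[OF that] by (intro closedin_Union) (auto simp: \<D>_def)
    moreover have "carrier G \<noteq> {}" using one_closed by blast
    ultimately show "closedin Z Q"
      unfolding Q_def by (intro closedin_Int closedin_Inter closedin_topspace) auto
  next
    fix x assume x: "x \<in> carrier G"
    show "shift G H x ` Q \<subseteq> Q"
    proof
      fix w assume "w \<in> shift G H x ` Q"
      then obtain z where z: "z \<in> Q" "w = shift G H x z" by auto
      have zZ: "z \<in> topspace Z" using z by (simp add: Q_def)
      show "w \<in> Q"
        unfolding Q_def
      proof (intro IntI INT_I)
        show "w \<in> topspace Z" using z zZ x by (simp add: shift_closed)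
        fix k g assume g: "g \<in> carrier G"
        have "z \<in> (\<Union>D\<in>\<D> k. E k (g \<otimes> x) D)" using z(1) g x by (auto simp: Q_def)
        then obtain D where D: "D \<in> \<D> k" "z \<in> E k (g \<otimes> x) D" by auto
        have "w (s \<otimes> g) = z (s \<otimes> (g \<otimes> x))" if "s \<in> D" for s
        proof -
          have "s \<in> carrier G" using that D(1) S(2)[of k] by (auto simp: \<D>_def)
          then show ?thesis using z g x zZ by (simp add: shift_apply m_assoc)
        qed
        then have "w \<in> E k g D" using D(2) \<open>w \<in> topspace Z\<close> by (simp add: E_def)
        then show "w \<in> (\<Union>D\<in>\<D> k. E k g D)" using D(1) by auto
      qed
    qed
  qed
  then obtain M where M: "M \<subseteq> Q" "minimal_set G Z (shift G H) M"
    using exists_minimal_set by blast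
  have sM: "subflow G Z (shift G H) M" using M by (simp add: minimal_set_def)
  note M' = subflowD[OF sM]
  obtain z where z: "z \<in> M" using M'(1) by auto
  define R where "R = (\<lambda>z. z \<one>) ` M"
  have "finite R" unfolding R_def by (rule minimal_set_finite_range[OF closed M(2)])
  have "z \<in> (\<Union>D\<in>\<D> (card R). E (card R) \<one> D)" using z M(1) by (auto simp: Q_def)
  then obtain D where D: "D \<subseteq> S (card R)" "card R < card D" "z \<in> E (card R) \<one> D" by (auto simp: \<D>_def)
  have Dc: "D \<subseteq> carrier G" using D(1) S(2) by auto
  have "inj_on z D"
  proof (rule inj_onI, rule ccontr)
    fix s t assume st: "s \<in> D" "t \<in> D" "z s = z t" "s \<noteq> t"
    then have "\<bar>z (s \<otimes> \<one>) - z (t \<otimes> \<one>)\<bar> \<ge> \<epsilon> (card R) / 2" using D(3) by (simp add: E_def)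
    moreover have "s \<otimes> \<one> = s" "t \<otimes> \<one> = t" using st Dc by auto
    ultimately show False using st \<epsilon>[rule_format, of "card R"] by simp
  qed
  moreover have "z ` D \<subseteq> R"
  proof
    fix v assume "v \<in> z ` D"
    then obtain s where s: "s \<in> D" "v = z s" by auto
    then have "s \<in> carrier G" using Dc by auto
    then have "shift G H s z \<in> M" "shift G H s z \<one> = z s"
      using M'(3,4) z by (auto simp: shift_apply subset_iff)
    then show "v \<in> R" unfolding R_def using s(2) by (metis imageI)
  qed
  ultimately have "card D \<le> card R" using card_inj_on_le \<open>finite R\<close> by blast
  with D(2) show False by simp
qed

end

section \<open>Compactness: finitely many translates suffice\<close>

lemma openin_product_discrete_finite_support:
  assumes F: "finite F" "F \<subseteq> I" and A: "A \<subseteq> (I \<rightarrow>\<^sub>E C)"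
    and dep: "\<And>\<gamma> \<gamma>'. \<gamma> \<in> A \<Longrightarrow> \<gamma>' \<in> I \<rightarrow>\<^sub>E C \<Longrightarrow> (\<And>i. i \<in> F \<Longrightarrow> \<gamma>' i = \<gamma> i) \<Longrightarrow> \<gamma>' \<in> A"
  shows "openin (product_topology (\<lambda>_. discrete_topology C) I) A"
  unfolding openin_product_topology_alt
proof
  fix \<gamma> assume \<gamma>: "\<gamma> \<in> A"
  define U where "U i = (if i \<in> F then {\<gamma> i} else C)" for i
  have "{i \<in> I. U i \<noteq> topspace (discrete_topology C)} \<subseteq> F" by (auto simp: U_def)
  then have "finite {i \<in> I. U i \<noteq> topspace (discrete_topology C)}" using F(1) finite_subset by blast
  moreover have "\<forall>i\<in>I. openin (discrete_topology C) (U i)"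
    using \<gamma> A by (auto simp: U_def)
  moreover have "\<gamma> \<in> Pi\<^sub>E I U"
    using \<gamma> A by (auto simp: U_def PiE_def Pi_def)
  moreover have "Pi\<^sub>E I U \<subseteq> A"
  proof
    fix \<gamma>' assume \<gamma>': "\<gamma>' \<in> Pi\<^sub>E I U"
    have "\<gamma>' i \<in> C" if "i \<in> I" for i
      using PiE_mem[OF \<gamma>' that] \<gamma> A that by (auto simp: U_def split: if_splits)
    then have "\<gamma>' \<in> I \<rightarrow>\<^sub>E C" using \<gamma>' by (auto simp: PiE_def)
    moreover have "\<gamma>' i = \<gamma> i" if "i \<in> F" for i
      using PiE_mem[OF \<gamma>', of i] that F(2) by (auto simp: U_def)
    ultimately show "\<gamma>' \<in> A" using dep[OF \<gamma>] by simp
  qed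
  ultimately show "\<exists>U. finite {i \<in> I. U i \<noteq> topspace (discrete_topology C)} \<and>
      (\<forall>i\<in>I. openin (discrete_topology C) (U i)) \<and> \<gamma> \<in> Pi\<^sub>E I U \<and> Pi\<^sub>E I U \<subseteq> A"
    by (intro exI[of _ U]) simp
qed

text \<open>In the compact space of all \<open>r\<close>-colorings, each coloring either violates invariance at some
  pair \<open>(h, g)\<close> or has few colors on some translate of \<open>S\<close>. These are open conditions, so
  finitely many of them cover the space.\<close>

lemma (in group) few_colors_finite_window:
  assumes few: "few_colors G H k" and H: "H \<subseteq> carrier G" and S: "finite S" "S \<subseteq> carrier G"
  shows "\<exists>W. finite W \<and> W \<subseteq> carrier G \<and> (\<forall>\<gamma>\<in>carrier G \<rightarrow> {..<r::nat}. left_invariant G H \<gamma> \<longrightarrow>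
    (\<exists>g\<in>W. card ((\<lambda>s. \<gamma> (s \<otimes> g)) ` S) \<le> k))"
proof -
  define C where "C = carrier G \<rightarrow>\<^sub>E {..<r}"
  define P where "P = product_topology (\<lambda>_. discrete_topology {..<r}) (carrier G)"
  define Good where "Good g = {\<gamma> \<in> C. card ((\<lambda>s. \<gamma> (s \<otimes> g)) ` S) \<le> k}" for g
  define Bad where "Bad = (\<lambda>(h, g). {\<gamma> \<in> C. \<gamma> (h \<otimes> g) \<noteq> \<gamma> g})"
  have Good: "openin P (Good g)" if g: "g \<in> carrier G" for g
    unfolding P_def
  proof (rule openin_product_discrete_finite_support[where F = "(\<lambda>s. s \<otimes> g) ` S"])
    fix \<gamma> \<gamma>' assume \<gamma>: "\<gamma> \<in> Good g" and \<gamma>': "\<gamma>' \<in> carrier G \<rightarrow>\<^sub>E {..<r}"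
      and eq: "\<And>i. i \<in> (\<lambda>s. s \<otimes> g) ` S \<Longrightarrow> \<gamma>' i = \<gamma> i"
    have "(\<lambda>s. \<gamma>' (s \<otimes> g)) ` S = (\<lambda>s. \<gamma> (s \<otimes> g)) ` S"
      using eq by (intro image_cong) auto
    then show "\<gamma>' \<in> Good g" using \<gamma> \<gamma>' by (simp add: Good_def C_def)
  qed (use S g in \<open>auto simp: Good_def C_def\<close>)
  have Bad: "openin P (Bad p)" if p: "p \<in> H \<times> carrier G" for p
  proof -
    obtain h g where hg: "p = (h, g)" "h \<in> carrier G" "g \<in> carrier G" using p H by auto
    show ?thesis
      unfolding P_def
      by (rule openin_product_discrete_finite_support[where F = "{h \<otimes> g, g}"])
        (use hg in \<open>auto simp: Bad_def C_def\<close>)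
  qed
  have topP: "topspace P = C" by (simp add: P_def C_def)
  have "compact_space P"
    unfolding P_def by (simp add: compact_space_product_topology compact_space_discrete_topology)
  then have "compactin P C" using topP by (simp add: compact_space_def)
  moreover have "openin P V" if "V \<in> Good ` carrier G \<union> Bad ` (H \<times> carrier G)" for V
    using that Good Bad by blast
  moreover have "C \<subseteq> \<Union>(Good ` carrier G \<union> Bad ` (H \<times> carrier G))"
  proof
    fix \<gamma> assume \<gamma>: "\<gamma> \<in> C"
    show "\<gamma> \<in> \<Union>(Good ` carrier G \<union> Bad ` (H \<times> carrier G))"
    proof (cases "left_invariant G H \<gamma>")
      case True
      moreover have "\<gamma> \<in> carrier G \<rightarrow> {..<r}" using \<gamma> by (auto simp: C_def)
      ultimately obtain g where "g \<in> carrier G" "card ((\<lambda>s. \<gamma> (s \<otimes> g)) ` S) \<le> k"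
        using few S unfolding few_colors_def by meson
      then show ?thesis using \<gamma> by (auto simp: Good_def)
    next
      case False
      then obtain h g where "h \<in> H" "g \<in> carrier G" "\<gamma> (h \<otimes> g) \<noteq> \<gamma> g"
        unfolding left_invariant_def by blast
      then have "\<gamma> \<in> Bad (h, g)" "(h, g) \<in> H \<times> carrier G" using \<gamma> by (auto simp: Bad_def)
      then show ?thesis by blast
    qed
  qed
  ultimately have "\<exists>F. finite F \<and> F \<subseteq> Good ` carrier G \<union> Bad ` (H \<times> carrier G) \<and> C \<subseteq> \<Union>F"
    by (rule compactinD)
  then obtain F where F: "finite F" "F \<subseteq> Good ` carrier G \<union> Bad ` (H \<times> carrier G)" "C \<subseteq> \<Union>F"
    by (elim exE conjE) (rule that)
  have "finite (F \<inter> Good ` carrier G)" "F \<inter> Good ` carrier G \<subseteq> Good ` carrier G" using F(1) by auto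
  then obtain W where W: "W \<subseteq> carrier G" "finite W" "F \<inter> Good ` carrier G = Good ` W"
    by (rule finite_subset_image[THEN exE]) (elim conjE, rule that)
  have "\<exists>g\<in>W. card ((\<lambda>s. \<gamma> (s \<otimes> g)) ` S) \<le> k"
    if \<gamma>: "\<gamma> \<in> carrier G \<rightarrow> {..<r}" "left_invariant G H \<gamma>" for \<gamma>
  proof -
    define \<gamma>' where "\<gamma>' = restrict \<gamma> (carrier G)"
    have "\<gamma>' \<in> C" using \<gamma>(1) by (auto simp: \<gamma>'_def C_def)
    then obtain V where V: "V \<in> F" "\<gamma>' \<in> V" using F(3) by blast
    have "V \<notin> Bad ` (H \<times> carrier G)"
      using V(2) \<gamma>(2) H by (auto simp: Bad_def \<gamma>'_def left_invariant_def)
    then have "V \<in> Good ` W" using V(1) F(2) W(3) by blast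
    then obtain g where g: "g \<in> W" "\<gamma>' \<in> Good g" using V(2) by blast
    have "(\<lambda>s. \<gamma>' (s \<otimes> g)) ` S = (\<lambda>s. \<gamma> (s \<otimes> g)) ` S"
      using g(1) W(1) S(2) by (intro image_cong) (auto simp: \<gamma>'_def)
    then show ?thesis using g by (auto simp: Good_def)
  qed
  then show ?thesis using W by (intro exI[of _ W]) simp
qed

section \<open>Embeddings and homogeneity\<close>

lemma Emb_closed: "f \<in> Emb L A B \<Longrightarrow> x \<in> universe A \<Longrightarrow> f x \<in> universe B"
  by (auto simp: Emb_def)

lemma Emb_inj: "f \<in> Emb L A B \<Longrightarrow> inj_on f (universe A)"
  by (simp add: Emb_def)

lemma Emb_interp:
  "f \<in> Emb L A B \<Longrightarrow> R \<in> symbols L \<Longrightarrow> xs \<in> tuples (universe A) (arity L R) \<Longrightarrow>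
    map f xs \<in> interp B R \<longleftrightarrow> xs \<in> interp A R"
  by (auto simp: Emb_def)

lemma tuples_map_closed:
  "xs \<in> tuples A n \<Longrightarrow> (\<And>x. x \<in> A \<Longrightarrow> f x \<in> B) \<Longrightarrow> map f xs \<in> tuples B n"
  by (auto simp: tuples_def)

lemma EmbI:
  assumes "f \<in> extensional (universe A)" "\<And>x. x \<in> universe A \<Longrightarrow> f x \<in> universe B" "inj_on f (universe A)"
    "\<And>R xs. R \<in> symbols L \<Longrightarrow> xs \<in> tuples (universe A) (arity L R) \<Longrightarrow>
      map f xs \<in> interp B R \<longleftrightarrow> xs \<in> interp A R"
  shows "f \<in> Emb L A B"
  using assms by (auto simp: Emb_def PiE_def)

lemma Emb_compose:
  assumes j: "j \<in> Emb L A B" and i: "i \<in> Emb L B C"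
  shows "compose (universe A) i j \<in> Emb L A C"
proof (rule EmbI)
  show "compose (universe A) i j \<in> extensional (universe A)" by simp
  show "compose (universe A) i j x \<in> universe C" if "x \<in> universe A" for x
    using that Emb_closed[OF j that] Emb_closed[OF i] by (simp add: compose_eq)
  show "inj_on (compose (universe A) i j) (universe A)"
    using Emb_inj[OF j] Emb_inj[OF i] Emb_closed[OF j]
    by (auto simp: inj_on_def compose_eq)
next
  fix R xs assume R: "R \<in> symbols L" and xs: "xs \<in> tuples (universe A) (arity L R)"
  have "map (compose (universe A) i j) xs = map i (map j xs)"
    using xs by (auto simp: tuples_def compose_def)
  moreover have "map i (map j xs) \<in> interp C R \<longleftrightarrow> map j xs \<in> interp B R"
    by (rule Emb_interp[OF i R tuples_map_closed[OF xs Emb_closed[OF j]]])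
  ultimately show "map (compose (universe A) i j) xs \<in> interp C R \<longleftrightarrow> xs \<in> interp A R"
    using Emb_interp[OF j R xs] by metis
qed

lemma universe_substructure [simp]: "universe (substructure K X) = X"
  by (simp add: substructure_def)

lemma interp_substructure:
  "xs \<in> tuples X n \<Longrightarrow> xs \<in> interp (substructure K X) R \<longleftrightarrow> xs \<in> interp K R"
  by (auto simp: substructure_def tuples_def)

lemma Emb_substructureI:
  assumes e: "e \<in> Emb L A K" and Y: "e ` universe A \<subseteq> Y"
  shows "e \<in> Emb L A (substructure K Y)"
proof (rule EmbI)
  show "e \<in> extensional (universe A)" using e by (auto simp: Emb_def PiE_def)
  show "e x \<in> universe (substructure K Y)" if "x \<in> universe A" for x using that Y by auto
  show "inj_on e (universe A)" by (rule Emb_inj[OF e])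
  fix R xs assume R: "R \<in> symbols L" and xs: "xs \<in> tuples (universe A) (arity L R)"
  have "map e xs \<in> tuples Y (arity L R)" using tuples_map_closed[OF xs, of e Y] Y by auto
  then show "map e xs \<in> interp (substructure K Y) R \<longleftrightarrow> xs \<in> interp A R"
    by (simp add: interp_substructure Emb_interp[OF e R xs])
qed

lemma inclusion_Emb:
  assumes "X \<subseteq> universe K"
  shows "restrict (\<lambda>x. x) X \<in> Emb L (substructure K X) K"
proof (rule EmbI)
  fix R xs assume "R \<in> symbols L" and xs: "xs \<in> tuples (universe (substructure K X)) (arity L R)"
  then have "map (restrict (\<lambda>x. x) X) xs = xs" by (intro map_idI) (auto simp: tuples_def)
  then show "map (restrict (\<lambda>x. x) X) xs \<in> interp K R \<longleftrightarrow> xs \<in> interp (substructure K X) R"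
    using xs by (simp add: interp_substructure)
qed (use assms in \<open>auto simp: inj_on_def\<close>)

lemma substructure_Age:
  assumes "is_structure L K" "finite X" "X \<subseteq> universe K"
  shows "substructure K X \<in> Age L K"
proof -
  have "is_structure L (substructure K X)"
    using assms(1) by (auto simp: is_structure_def substructure_def tuples_def)
  moreover have "embeds L (substructure K X) K"
    using inclusion_Emb[OF assms(3)] by (auto simp: embeds_def)
  ultimately show ?thesis using assms(2) by (simp add: Age_def)
qed

lemma finite_Emb: "finite (universe A) \<Longrightarrow> finite (universe B) \<Longrightarrow> finite (Emb L A B)"
  by (rule finite_subset[of _ "universe A \<rightarrow>\<^sub>E universe B"]) (auto simp: Emb_def intro: finite_PiE)

lemma Aut_Emb: "g \<in> Aut L K \<Longrightarrow> g \<in> Emb L K K"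
  by (simp add: isos_def)

lemma restrict_Aut_Emb:
  assumes g: "g \<in> Aut L K" and X: "X \<subseteq> universe K" and Y: "g ` X \<subseteq> Y"
  shows "restrict g X \<in> Emb L (substructure K X) (substructure K Y)"
proof -
  have "compose X g (restrict (\<lambda>x. x) X) \<in> Emb L (substructure K X) K"
    using Emb_compose[OF inclusion_Emb[OF X] Aut_Emb[OF g]] by simp
  moreover have "compose X g (restrict (\<lambda>x. x) X) = restrict g X" by (auto simp: compose_def)
  ultimately show ?thesis using Y by (intro Emb_substructureI) auto
qed

text \<open>Homogeneity is stated for substructures of \<open>K\<close>; in this form it applies to any two
  embeddings \<open>e1\<close>, \<open>e2\<close> of the same structure, through the isomorphism \<open>e2 \<circ> e1\<inverse>\<close> between their
  images.\<close>

lemma omega_homogeneous_extend: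
  assumes hom: "omega_homogeneous L K" and fin: "finite (universe A)"
    and e1: "e1 \<in> Emb L A K" and e2: "e2 \<in> Emb L A K"
  shows "\<exists>g\<in>Aut L K. \<forall>x\<in>universe A. g (e1 x) = e2 x"
proof -
  let ?X = "e1 ` universe A" and ?Y = "e2 ` universe A"
  define f where "f = restrict (\<lambda>y. e2 (inv_into (universe A) e1 y)) ?X"
  have f: "f (e1 x) = e2 x" if "x \<in> universe A" for x
    using that Emb_inj[OF e1] by (simp add: f_def inv_into_f_f)
  have "f \<in> Emb L (substructure K ?X) (substructure K ?Y)"
  proof (rule EmbI)
    show "f \<in> extensional (universe (substructure K ?X))" by (simp add: f_def)
    show "f y \<in> universe (substructure K ?Y)" if "y \<in> universe (substructure K ?X)" for y
      using that f by auto
    show "inj_on f (universe (substructure K ?X))"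
      using Emb_inj[OF e1] Emb_inj[OF e2] f by (auto simp: inj_on_def)
    fix R xs assume R: "R \<in> symbols L" and xs: "xs \<in> tuples (universe (substructure K ?X)) (arity L R)"
    define ys where "ys = map (inv_into (universe A) e1) xs"
    have ys: "ys \<in> tuples (universe A) (arity L R)"
      unfolding ys_def using xs by (intro tuples_map_closed[of _ ?X]) (auto intro: inv_into_into)
    have xs_ys: "xs = map e1 ys"
      unfolding ys_def map_map using xs
      by (intro map_idI[symmetric]) (auto simp: tuples_def f_inv_into_f subset_iff)
    have "map f xs = map e2 ys"
      unfolding xs_ys using ys f by (auto simp: tuples_def)
    moreover have "map e2 ys \<in> tuples ?Y (arity L R)" using tuples_map_closed[OF ys, of e2 ?Y] by auto
    ultimately show "map f xs \<in> interp (substructure K ?Y) R \<longleftrightarrow> xs \<in> interp (substructure K ?X) R"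
      using xs by (simp add: interp_substructure Emb_interp[OF e2 R ys]) (simp add: xs_ys Emb_interp[OF e1 R ys])
  qed
  moreover have "f ` ?X = ?Y" using f by (force simp: image_iff)
  ultimately have "f \<in> isos L (substructure K ?X) (substructure K ?Y)" by (simp add: isos_def)
  moreover have "finite ?X" "finite ?Y" "?X \<subseteq> universe K" "?Y \<subseteq> universe K"
    using fin Emb_closed[OF e1] Emb_closed[OF e2] by auto
  ultimately obtain g where "g \<in> Aut L K" "\<forall>y\<in>?X. g y = f y"
    using hom unfolding omega_homogeneous_def by metis
  then show ?thesis using f by (intro bexI[of _ g]) auto
qed

section \<open>Ramsey degrees as a property of stabilizers\<close>

definition pointwise_stabilizer :: "'r language \<Rightarrow> ('a, 'r) rel_struct \<Rightarrow> 'a set \<Rightarrow> ('a \<Rightarrow> 'a) set" where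
  "pointwise_stabilizer L K F = {g \<in> Aut L K. \<forall>x\<in>F. g x = x}"

context
  fixes L :: "'r language" and K :: "('a, 'r) rel_struct"
begin

interpretation G: group "aut_group L K" by (rule group_aut_group)

abbreviation (input) "GK \<equiv> aut_group L K"

abbreviation (input) ginv :: "('a \<Rightarrow> 'a) \<Rightarrow> 'a \<Rightarrow> 'a" where
  "ginv g \<equiv> inv\<^bsub>GK\<^esub> g"

lemma carrier_aut_group: "carrier GK = Aut L K"
  by (simp add: aut_group_def)

lemma aut_closed: "g \<in> Aut L K \<Longrightarrow> x \<in> universe K \<Longrightarrow> g x \<in> universe K"
  using Emb_closed[OF Aut_Emb] .

lemma aut_mult:
  "g \<in> Aut L K \<Longrightarrow> h \<in> Aut L K \<Longrightarrow> x \<in> universe K \<Longrightarrow> (g \<otimes>\<^bsub>GK\<^esub> h) x = g (h x)"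
  by (simp add: aut_group_def BijGroup_def Aut_iff compose_eq)

lemma aut_one: "x \<in> universe K \<Longrightarrow> \<one>\<^bsub>GK\<^esub> x = x"
  by (simp add: aut_group_def BijGroup_def)

lemma aut_mult_closed: "g \<in> Aut L K \<Longrightarrow> h \<in> Aut L K \<Longrightarrow> g \<otimes>\<^bsub>GK\<^esub> h \<in> Aut L K"
  using G.m_closed by (simp add: carrier_aut_group)

lemma aut_inv_closed: "g \<in> Aut L K \<Longrightarrow> ginv g \<in> Aut L K"
  using G.inv_closed by (simp add: carrier_aut_group)

lemma aut_one_closed: "\<one>\<^bsub>GK\<^esub> \<in> Aut L K"
  using G.one_closed by (simp add: carrier_aut_group)

lemma aut_inv_left:
  assumes "g \<in> Aut L K" "x \<in> universe K"
  shows "ginv g (g x) = x"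
proof -
  have "ginv g (g x) = (ginv g \<otimes>\<^bsub>GK\<^esub> g) x" using assms by (simp add: aut_mult aut_inv_closed)
  also have "\<dots> = x" using assms G.l_inv[of g] by (simp add: carrier_aut_group aut_one)
  finally show ?thesis .
qed

lemma aut_inv_right:
  assumes "g \<in> Aut L K" "x \<in> universe K"
  shows "g (ginv g x) = x"
proof -
  have "g (ginv g x) = (g \<otimes>\<^bsub>GK\<^esub> ginv g) x" using assms by (simp add: aut_mult aut_inv_closed)
  also have "\<dots> = x" using assms G.r_inv[of g] by (simp add: carrier_aut_group aut_one)
  finally show ?thesis .
qed

lemma subgroup_pointwise_stabilizer:
  assumes F: "F \<subseteq> universe K"
  shows "subgroup (pointwise_stabilizer L K F) GK"
proof (rule G.subgroupI)
  show "pointwise_stabilizer L K F \<subseteq> carrier GK"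
    by (auto simp: pointwise_stabilizer_def carrier_aut_group)
  have "\<one>\<^bsub>GK\<^esub> \<in> pointwise_stabilizer L K F"
    using F aut_one aut_one_closed by (auto simp: pointwise_stabilizer_def)
  then show "pointwise_stabilizer L K F \<noteq> {}" by blast
next
  fix g assume g: "g \<in> pointwise_stabilizer L K F"
  have "ginv g x = x" if "x \<in> F" for x
    using aut_inv_left[of g x] g that F by (auto simp: pointwise_stabilizer_def)
  then show "ginv g \<in> pointwise_stabilizer L K F"
    using g by (simp add: pointwise_stabilizer_def aut_inv_closed)
  fix h assume h: "h \<in> pointwise_stabilizer L K F"
  have "(g \<otimes>\<^bsub>GK\<^esub> h) x = x" if "x \<in> F" for x
    using g h that F aut_mult[of g h x] by (auto simp: pointwise_stabilizer_def)
  then show "g \<otimes>\<^bsub>GK\<^esub> h \<in> pointwise_stabilizer L K F"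
    using g h by (simp add: pointwise_stabilizer_def aut_mult_closed)
qed

text \<open>The color of \<open>g\<close> depends only on the embedding \<open>e\<close>, the restriction of \<open>g\<inverse>\<close> to \<open>F\<close>.\<close>

lemma left_invariant_stabilizer_eq:
  assumes inv: "left_invariant GK (pointwise_stabilizer L K F) \<gamma>" and F: "F \<subseteq> universe K"
    and g: "g \<in> Aut L K" "g' \<in> Aut L K"
    and e: "\<And>x. x \<in> F \<Longrightarrow> e x \<in> universe K" "\<And>x. x \<in> F \<Longrightarrow> g (e x) = x" "\<And>x. x \<in> F \<Longrightarrow> g' (e x) = x"
  shows "\<gamma> g = \<gamma> g'"
proof -
  let ?h = "g' \<otimes>\<^bsub>GK\<^esub> ginv g"
  have "?h x = x" if x: "x \<in> F" for x
  proof -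
    have "ginv g x = e x" using aut_inv_left[OF g(1) e(1)[OF x]] e(2)[OF x] by simp
    then show ?thesis using aut_mult[OF g(2) aut_inv_closed[OF g(1)], of x] x F e(3)[OF x] by auto
  qed
  then have "?h \<in> pointwise_stabilizer L K F"
    using g by (simp add: pointwise_stabilizer_def aut_mult_closed aut_inv_closed)
  then have "\<gamma> (?h \<otimes>\<^bsub>GK\<^esub> g) = \<gamma> g"
    using inv g by (simp add: left_invariant_def carrier_aut_group)
  moreover have "?h \<otimes>\<^bsub>GK\<^esub> g = g'"
    using g by (simp add: G.m_assoc carrier_aut_group aut_inv_closed)
  ultimately show ?thesis by simp
qed

text \<open>Take for \<open>B\<close> the substructure on the union of the sets \<open>s\<inverse> F\<close>, \<open>s \<in> S\<close>, so that every \<open>s\<close>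
  gives an embedding of \<open>K|F\<close> into \<open>B\<close>. Place the structure \<open>C\<close> inside \<open>K\<close> and pull \<open>\<gamma>\<close> back to
  the embeddings into \<open>C\<close>. The copy of \<open>B\<close> with few colors extends to an automorphism, and its
  inverse \<open>p\<close> is the translate that is wanted.\<close>

theorem ramsey_bound_imp_few_colors:
  assumes K: "is_structure L K" "omega_homogeneous L K" and F: "finite F" "F \<subseteq> universe K"
    and ram: "ramsey_bound L K (substructure K F) k"
  shows "few_colors GK (pointwise_stabilizer L K F) k"
  unfolding few_colors_def
proof (intro allI impI, elim conjE)
  fix r :: nat and \<gamma> S
  assume S: "finite S" "S \<subseteq> carrier GK" and \<gamma>: "\<gamma> \<in> carrier GK \<rightarrow> {..<r}"
    and inv: "left_invariant GK (pointwise_stabilizer L K F) \<gamma>"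
  let ?A = "substructure K F"
  show "\<exists>g\<in>carrier GK. card ((\<lambda>s. \<gamma> (s \<otimes>\<^bsub>GK\<^esub> g)) ` S) \<le> k"
  proof (cases "S = {}")
    case True
    then show ?thesis using aut_one_closed by (auto simp: carrier_aut_group)
  next
    case False
    have SA: "s \<in> Aut L K" if "s \<in> S" for s using that S by (auto simp: carrier_aut_group)
    define Y where "Y = (\<Union>s\<in>S. ginv s ` F)"
    let ?B = "substructure K Y"
    have Y: "finite Y" "Y \<subseteq> universe K"
    proof -
      show "finite Y" using S(1) F(1) by (simp add: Y_def)
      show "Y \<subseteq> universe K"
      proof
        fix y assume "y \<in> Y"
        then obtain s x where "s \<in> S" "x \<in> F" "y = ginv s x" by (auto simp: Y_def)
        then show "y \<in> universe K" using aut_closed[OF aut_inv_closed[OF SA]] F(2) by blast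
      qed
    qed
    have B: "?B \<in> Age L K" by (rule substructure_Age[OF K(1) Y])
    have js: "restrict (ginv s) F \<in> Emb L ?A ?B" if "s \<in> S" for s
      using that SA F by (intro restrict_Aut_Emb aut_inv_closed) (auto simp: Y_def)
    have AB: "embeds L ?A ?B" using js False by (auto simp: embeds_def)
    \<comment> \<open>The Ramsey bound speaks only of colorings with at least \<open>k\<close> colors, hence the maximum.\<close>
    have "\<exists>C\<in>Age L K. embeds L ?B C \<and>
           (\<forall>\<gamma>\<in>Emb L ?A C \<rightarrow> {..<max r k}. \<exists>i\<in>Emb L ?B C.
              card {\<gamma> (compose (universe ?A) i j) | j. j \<in> Emb L ?A ?B} \<le> k)"
      using ram[unfolded ramsey_bound_def, rule_format, of "max r k" ?B] B AB by simp
    then obtain C where C: "C \<in> Age L K"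
      and col: "\<And>\<gamma>. \<gamma> \<in> Emb L ?A C \<rightarrow> {..<max r k} \<Longrightarrow> \<exists>i\<in>Emb L ?B C.
              card {\<gamma> (compose F i j) | j. j \<in> Emb L ?A ?B} \<le> k"
      by auto
    obtain e where e: "e \<in> Emb L C K" using C by (auto simp: Age_def embeds_def)
    define P where "P j g \<longleftrightarrow> g \<in> Aut L K \<and> (\<forall>x\<in>F. g (e (j x)) = x)" for j g
    define \<gamma>' where "\<gamma>' j = \<gamma> (SOME g. P j g)" for j
    have exP: "\<exists>g. P j g" if j: "j \<in> Emb L ?A C" for j
      using omega_homogeneous_extend[OF K(2) _ Emb_compose[OF j e] inclusion_Emb[OF F(2)]] F(1)
      by (auto simp: P_def compose_eq)
    have \<gamma>'_eq: "\<gamma>' j = \<gamma> g" if j: "j \<in> Emb L ?A C" and g: "P j g" for j g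
      unfolding \<gamma>'_def
    proof (rule left_invariant_stabilizer_eq[OF inv F(2)])
      have some: "P j (SOME g. P j g)" using exP[OF j] by (rule someI_ex)
      show "(SOME g. P j g) \<in> Aut L K" "g \<in> Aut L K" using some g by (auto simp: P_def)
      fix x assume x: "x \<in> F"
      show "(SOME g. P j g) (e (j x)) = x" "g (e (j x)) = x" using some g x by (auto simp: P_def)
      show "e (j x) \<in> universe K" using x Emb_closed[OF j] Emb_closed[OF e] by simp
    qed
    have "\<gamma>' \<in> Emb L ?A C \<rightarrow> {..<max r k}"
    proof
      fix j assume j: "j \<in> Emb L ?A C"
      then obtain g where g: "P j g" using exP by blast
      then have "\<gamma> g < r" using \<gamma> by (auto simp: P_def carrier_aut_group)
      then show "\<gamma>' j \<in> {..<max r k}" using \<gamma>'_eq[OF j g] by simp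
    qed
    then obtain i where i: "i \<in> Emb L ?B C"
      and card: "card {\<gamma>' (compose F i j) | j. j \<in> Emb L ?A ?B} \<le> k"
      using col by blast
    obtain p where p: "p \<in> Aut L K" "\<And>y. y \<in> Y \<Longrightarrow> p (e (i y)) = y"
      using omega_homogeneous_extend[OF K(2) _ Emb_compose[OF i e] inclusion_Emb[OF Y(2)]] Y(1)
      by (auto simp: compose_eq)
    have "\<gamma> (s \<otimes>\<^bsub>GK\<^esub> p) \<in> {\<gamma>' (compose F i j) | j. j \<in> Emb L ?A ?B}" if s: "s \<in> S" for s
    proof -
      let ?j = "restrict (ginv s) F"
      have "P (compose F i ?j) (s \<otimes>\<^bsub>GK\<^esub> p)"
        unfolding P_def
      proof (intro conjI ballI)
        show "s \<otimes>\<^bsub>GK\<^esub> p \<in> Aut L K" using SA[OF s] p aut_mult_closed by simp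
        fix x assume x: "x \<in> F"
        let ?y = "ginv s x"
        have y: "?y \<in> Y" using x s by (auto simp: Y_def)
        have "e (i ?y) \<in> universe K" using y Emb_closed[OF i] Emb_closed[OF e] by simp
        then show "(s \<otimes>\<^bsub>GK\<^esub> p) (e (compose F i ?j x)) = x"
          using x y F(2) SA[OF s] p aut_inv_right[OF SA[OF s], of x]
          by (auto simp: compose_eq aut_mult)
      qed
      moreover have "compose F i ?j \<in> Emb L ?A C" using Emb_compose[OF js[OF s] i] by simp
      ultimately have "\<gamma> (s \<otimes>\<^bsub>GK\<^esub> p) = \<gamma>' (compose F i ?j)" using \<gamma>'_eq by simp
      then show ?thesis using js[OF s] by blast
    qed
    then have "(\<lambda>s. \<gamma> (s \<otimes>\<^bsub>GK\<^esub> p)) ` S \<subseteq> {\<gamma>' (compose F i j) | j. j \<in> Emb L ?A ?B}" by blast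
    moreover have "finite {\<gamma>' (compose F i j) | j. j \<in> Emb L ?A ?B}"
      using finite_Emb[of ?A ?B L] F(1) Y(1) by simp
    ultimately have "card ((\<lambda>s. \<gamma> (s \<otimes>\<^bsub>GK\<^esub> p)) ` S) \<le> k"
      using card card_mono le_trans by blast
    then show ?thesis using p by (auto simp: carrier_aut_group)
  qed
qed

text \<open>The embeddings \<open>j\<close> of \<open>A\<close> into \<open>B\<close> become a window of group elements \<open>s j\<close>, and \<open>C\<close> is the
  union of the copies \<open>g\<inverse> B\<close>, where \<open>g\<close> ranges over the finite set \<open>W\<close> of translates that
  suffices by compactness. A coloring of the embeddings into \<open>C\<close> is transported to \<open>G\<close>.\<close>

theorem few_colors_imp_ramsey_bound:
  assumes K: "is_structure L K" "omega_homogeneous L K"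
    and A: "A \<in> Age L K" and a: "a \<in> Emb L A K"
    and few: "few_colors GK (pointwise_stabilizer L K (a ` universe A)) k"
  shows "ramsey_bound L K A k"
  unfolding ramsey_bound_def
proof (intro allI impI ballI)
  fix r :: nat and B assume B: "B \<in> Age L K" and AB: "embeds L A B"
  have finA: "finite (universe A)" and finB: "finite (universe B)" using A B by (auto simp: Age_def)
  obtain b where b: "b \<in> Emb L B K" using B by (auto simp: Age_def embeds_def)
  let ?H = "pointwise_stabilizer L K (a ` universe A)"
  have "\<exists>s\<in>Aut L K. \<forall>x\<in>universe A. s (b (j x)) = a x" if j: "j \<in> Emb L A B" for j
    using omega_homogeneous_extend[OF K(2) finA Emb_compose[OF j b] a] by (simp add: compose_eq)
  then obtain s where s: "\<And>j. j \<in> Emb L A B \<Longrightarrow> s j \<in> Aut L K"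
    "\<And>j x. j \<in> Emb L A B \<Longrightarrow> x \<in> universe A \<Longrightarrow> s j (b (j x)) = a x"
    by metis
  have "finite (s ` Emb L A B)" "s ` Emb L A B \<subseteq> carrier GK" "?H \<subseteq> carrier GK"
    using finite_Emb[OF finA finB] s(1) by (auto simp: carrier_aut_group pointwise_stabilizer_def)
  with G.few_colors_finite_window[OF few] obtain W0 where W0: "finite W0" "W0 \<subseteq> carrier GK"
    and win0: "\<forall>\<gamma>\<in>carrier GK \<rightarrow> {..<r}. left_invariant GK ?H \<gamma> \<longrightarrow>
      (\<exists>g\<in>W0. card ((\<lambda>s. \<gamma> (s \<otimes>\<^bsub>GK\<^esub> g)) ` s ` Emb L A B) \<le> k)"
    by meson
  \<comment> \<open>The neutral element is added to have a copy of \<open>B\<close> in \<open>C\<close> even if no translate is required.\<close>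
  define W where "W = insert \<one>\<^bsub>GK\<^esub> W0"
  have W: "finite W" "\<And>g. g \<in> W \<Longrightarrow> g \<in> Aut L K"
    using W0 aut_one_closed by (auto simp: W_def carrier_aut_group)
  define Y where "Y = (\<Union>g\<in>W. (\<lambda>x. ginv g (b x)) ` universe B)"
  let ?C = "substructure K Y"
  have Y: "finite Y" "Y \<subseteq> universe K"
  proof -
    show "finite Y" using W(1) finB by (simp add: Y_def)
    show "Y \<subseteq> universe K"
    proof
      fix y assume "y \<in> Y"
      then obtain g x where "g \<in> W" "x \<in> universe B" "y = ginv g (b x)" by (auto simp: Y_def)
      then show "y \<in> universe K"
        using aut_closed[OF aut_inv_closed[OF W(2)]] Emb_closed[OF b] by blast
    qed
  qed
  have ig: "compose (universe B) (ginv g) b \<in> Emb L B ?C" if "g \<in> W" for g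
    using that Emb_compose[OF b Aut_Emb[OF aut_inv_closed[OF W(2)]]]
    by (intro Emb_substructureI) (auto simp: Y_def compose_eq)
  have BC: "embeds L B ?C" using ig[of "\<one>\<^bsub>GK\<^esub>"] by (auto simp: embeds_def W_def)
  have "\<exists>i\<in>Emb L B ?C. card {\<gamma> (compose (universe A) i j) | j. j \<in> Emb L A B} \<le> k"
    if \<gamma>: "\<gamma> \<in> Emb L A ?C \<rightarrow> {..<r}" for \<gamma>
  proof -
    define e where "e g = compose (universe A) (ginv g) a" for g
    \<comment> \<open>Group elements whose embedding does not land in \<open>C\<close> get an arbitrary color; the set of
      these elements is invariant, so the coloring stays invariant.\<close>
    define \<gamma>' where "\<gamma>' g = (if e g \<in> Emb L A ?C then \<gamma> (e g) else 0)" for g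
    obtain j0 i0 where "j0 \<in> Emb L A B" "i0 \<in> Emb L B ?C" using AB BC by (auto simp: embeds_def)
    then have "compose (universe A) i0 j0 \<in> Emb L A ?C" by (rule Emb_compose)
    then have "r > 0" using \<gamma> by force
    then have "\<gamma>' \<in> carrier GK \<rightarrow> {..<r}" using \<gamma> by (auto simp: \<gamma>'_def)
    moreover have "left_invariant GK ?H \<gamma>'"
      unfolding left_invariant_def
    proof (intro ballI)
      fix h g assume h: "h \<in> ?H" and g: "g \<in> carrier GK"
      have hA: "h \<in> Aut L K" and gA: "g \<in> Aut L K"
        using h g by (auto simp: pointwise_stabilizer_def carrier_aut_group)
      have "ginv (h \<otimes>\<^bsub>GK\<^esub> g) (a x) = ginv g (a x)" if x: "x \<in> universe A" for x
      proof -
        have ax: "a x \<in> universe K" using x Emb_closed[OF a] by simp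
        have "h (a x) = a x" using h x by (auto simp: pointwise_stabilizer_def)
        then have "ginv h (a x) = a x" using aut_inv_left[OF hA ax] by simp
        moreover have "ginv (h \<otimes>\<^bsub>GK\<^esub> g) = ginv g \<otimes>\<^bsub>GK\<^esub> ginv h"
          using hA gA by (simp add: G.inv_mult_group carrier_aut_group)
        ultimately show ?thesis
          using aut_mult[OF aut_inv_closed[OF gA] aut_inv_closed[OF hA] ax] by simp
      qed
      then have "e (h \<otimes>\<^bsub>GK\<^esub> g) = e g" by (auto simp: e_def compose_def)
      then show "\<gamma>' (h \<otimes>\<^bsub>GK\<^esub> g) = \<gamma>' g" by (simp add: \<gamma>'_def)
    qed
    ultimately obtain g where g: "g \<in> W0" "card ((\<lambda>s. \<gamma>' (s \<otimes>\<^bsub>GK\<^esub> g)) ` s ` Emb L A B) \<le> k"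
      using win0 by blast
    have gW: "g \<in> W" and gA: "g \<in> Aut L K" using g W by (auto simp: W_def)
    let ?i = "compose (universe B) (ginv g) b"
    have "\<gamma> (compose (universe A) ?i j) = \<gamma>' (s j \<otimes>\<^bsub>GK\<^esub> g)" if j: "j \<in> Emb L A B" for j
    proof -
      note sj = s(1)[OF j]
      have "e (s j \<otimes>\<^bsub>GK\<^esub> g) x = compose (universe A) ?i j x" if x: "x \<in> universe A" for x
      proof -
        have ax: "a x \<in> universe K" using x Emb_closed[OF a] by simp
        have jx: "j x \<in> universe B" and bjx: "b (j x) \<in> universe K"
          using x Emb_closed[OF j] Emb_closed[OF b] by auto
        have "ginv (s j) (a x) = b (j x)"
          using aut_inv_left[OF sj bjx] s(2)[OF j x] by simp
        moreover have "ginv (s j \<otimes>\<^bsub>GK\<^esub> g) = ginv g \<otimes>\<^bsub>GK\<^esub> ginv (s j)"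
          using sj gA by (simp add: G.inv_mult_group carrier_aut_group)
        ultimately show ?thesis
          using x jx aut_mult[OF aut_inv_closed[OF gA] aut_inv_closed[OF sj] ax]
          by (simp add: e_def compose_eq)
      qed
      then have "e (s j \<otimes>\<^bsub>GK\<^esub> g) = compose (universe A) ?i j"
        by (intro extensionalityI[of _ "universe A"]) (auto simp: e_def)
      then show ?thesis using Emb_compose[OF j ig[OF gW]] by (simp add: \<gamma>'_def)
    qed
    then have "{\<gamma> (compose (universe A) ?i j) | j. j \<in> Emb L A B} =
        (\<lambda>s. \<gamma>' (s \<otimes>\<^bsub>GK\<^esub> g)) ` s ` Emb L A B"
      unfolding Setcompr_eq_image image_image by (intro image_cong) simp_all
    with g(2) ig[OF gW] show ?thesis by (intro bexI[of _ ?i]) simp_all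
  qed
  then show "\<exists>C\<in>Age L K. embeds L B C \<and>
      (\<forall>\<gamma>\<in>Emb L A C \<rightarrow> {..<r}. \<exists>i\<in>Emb L B C.
        card {\<gamma> (compose (universe A) i j) | j. j \<in> Emb L A B} \<le> k)"
    using BC substructure_Age[OF K(1) Y] by (intro bexI[of _ ?C]) auto
qed

lemma topspace_aut_topology: "topspace (aut_topology L K) = Aut L K"
  by (auto simp: aut_topology_def isos_def Emb_def)

lemma openin_aut_pointwise:
  assumes "finite F" "F \<subseteq> universe K"
  shows "openin (aut_topology L K) {g \<in> Aut L K. \<forall>x\<in>F. g x = v x}"
  using assms
proof (induction F)
  case empty
  then show ?case using openin_topspace[of "aut_topology L K"] by (simp add: topspace_aut_topology)
next
  case (insert x F)
  have "continuous_map (aut_topology L K) (discrete_topology (universe K)) (\<lambda>g. g x)"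
    unfolding aut_topology_def using insert
    by (intro continuous_map_from_subtopology continuous_map_product_projection) auto
  then have "openin (aut_topology L K) {g \<in> topspace (aut_topology L K). g x \<in> {v x} \<inter> universe K}"
    by (rule openin_continuous_map_preimage) simp
  then have "openin (aut_topology L K) ({g \<in> topspace (aut_topology L K). g x \<in> {v x} \<inter> universe K} \<inter>
      {g \<in> Aut L K. \<forall>x\<in>F. g x = v x})"
    using insert by (intro openin_Int) auto
  moreover have "{g \<in> topspace (aut_topology L K). g x \<in> {v x} \<inter> universe K} \<inter>
      {g \<in> Aut L K. \<forall>x\<in>F. g x = v x} = {g \<in> Aut L K. \<forall>x\<in>insert x F. g x = v x}"
    using insert aut_closed by (auto simp: topspace_aut_topology)
  ultimately show ?case by simp
qed

text \<open>Membership of \<open>h \<otimes> g'\<close> in the coset of \<open>h \<otimes> g\<close> depends only on the values of \<open>g'\<close> at the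
  finitely many points \<open>(h \<otimes> g)\<inverse> x\<close>, \<open>x \<in> F\<close>.\<close>

lemma coloring_flow_stabilizer:
  assumes F: "finite F" "F \<subseteq> universe K"
  shows "coloring_flow GK (aut_topology L K) (pointwise_stabilizer L K F)"
proof (intro coloring_flow.intro coloring_flow_axioms.intro G.is_group)
  show "topspace (aut_topology L K) = carrier GK"
    by (simp add: topspace_aut_topology carrier_aut_group)
  show sub: "subgroup (pointwise_stabilizer L K F) GK" by (rule subgroup_pointwise_stabilizer[OF F(2)])
  fix h g assume hg: "h \<in> carrier GK" "g \<in> carrier GK"
  then have A: "h \<in> Aut L K" "g \<in> Aut L K" by (simp_all add: carrier_aut_group)
  let ?i = "ginv (h \<otimes>\<^bsub>GK\<^esub> g)"
  have iA: "?i \<in> Aut L K" using A by (simp add: aut_mult_closed aut_inv_closed)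
  have "h \<otimes>\<^bsub>GK\<^esub> g' \<in> pointwise_stabilizer L K F #>\<^bsub>GK\<^esub> (h \<otimes>\<^bsub>GK\<^esub> g) \<longleftrightarrow>
      (\<forall>y\<in>?i ` F. g' y = g y)" if g': "g' \<in> Aut L K" for g'
  proof -
    have "h \<otimes>\<^bsub>GK\<^esub> g' \<in> pointwise_stabilizer L K F #>\<^bsub>GK\<^esub> (h \<otimes>\<^bsub>GK\<^esub> g) \<longleftrightarrow>
        (h \<otimes>\<^bsub>GK\<^esub> g') \<otimes>\<^bsub>GK\<^esub> ?i \<in> pointwise_stabilizer L K F"
      using subgroup.rcos_module[OF sub G.is_group, of "h \<otimes>\<^bsub>GK\<^esub> g" "h \<otimes>\<^bsub>GK\<^esub> g'"] A g'
      by (simp add: carrier_aut_group aut_mult_closed)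
    also have "\<dots> \<longleftrightarrow> (\<forall>x\<in>F. h (g' (?i x)) = x)"
      using A g' iA F(2)
      by (auto simp: pointwise_stabilizer_def aut_mult aut_mult_closed aut_closed subset_iff)
    also have "\<dots> \<longleftrightarrow> (\<forall>x\<in>F. g' (?i x) = g (?i x))"
    proof (rule ball_cong[OF refl])
      fix x assume x: "x \<in> F"
      have ix: "?i x \<in> universe K" using x F(2) iA aut_closed by blast
      have "h (g (?i x)) = x"
        using aut_inv_right[OF aut_mult_closed[OF A], of x] x F(2) aut_mult[OF A ix] by auto
      moreover have "inj_on h (universe K)" using Emb_inj[OF Aut_Emb[OF A(1)]] .
      ultimately show "h (g' (?i x)) = x \<longleftrightarrow> g' (?i x) = g (?i x)"
        using aut_closed[OF g' ix] aut_closed[OF A(2) ix] by (metis inj_onD)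
    qed
    finally show ?thesis by simp
  qed
  then have "{g' \<in> carrier GK. h \<otimes>\<^bsub>GK\<^esub> g' \<in> pointwise_stabilizer L K F #>\<^bsub>GK\<^esub> (h \<otimes>\<^bsub>GK\<^esub> g)} =
      {g' \<in> Aut L K. \<forall>y\<in>?i ` F. g' y = g y}"
    by (auto simp: carrier_aut_group)
  moreover have "openin (aut_topology L K) \<dots>"
    using F iA aut_closed by (intro openin_aut_pointwise) auto
  ultimately show "openin (aut_topology L K)
      {g' \<in> carrier GK. h \<otimes>\<^bsub>GK\<^esub> g' \<in> pointwise_stabilizer L K F #>\<^bsub>GK\<^esub> (h \<otimes>\<^bsub>GK\<^esub> g)}"
    by simp
qed

lemma stabilizer_neighborhood_basis:
  assumes V: "openin (aut_topology L K) V" "\<one>\<^bsub>GK\<^esub> \<in> V"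
  shows "\<exists>F. finite F \<and> F \<subseteq> universe K \<and> pointwise_stabilizer L K F \<subseteq> V"
proof -
  obtain V' where V': "openin (product_topology (\<lambda>_. discrete_topology (universe K)) (universe K)) V'"
    "V = V' \<inter> Aut L K"
    using V(1) unfolding aut_topology_def openin_subtopology by blast
  obtain U where U: "finite {i \<in> universe K. U i \<noteq> topspace (discrete_topology (universe K))}"
    "\<one>\<^bsub>GK\<^esub> \<in> Pi\<^sub>E (universe K) U" "Pi\<^sub>E (universe K) U \<subseteq> V'"
    using V'(1) V(2) V'(2) unfolding openin_product_topology_alt by blast
  define F where "F = {i \<in> universe K. U i \<noteq> universe K}"
  have "pointwise_stabilizer L K F \<subseteq> V"
  proof
    fix g assume g: "g \<in> pointwise_stabilizer L K F"
    then have gA: "g \<in> Aut L K" by (simp add: pointwise_stabilizer_def)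
    have "g i \<in> U i" if i: "i \<in> universe K" for i
    proof (cases "i \<in> F")
      case True
      then have "g i = i" using g by (simp add: pointwise_stabilizer_def)
      then show ?thesis using PiE_mem[OF U(2) i] aut_one[OF i] by simp
    next
      case False
      then show ?thesis using i aut_closed[OF gA i] by (simp add: F_def)
    qed
    moreover have "g \<in> extensional (universe K)" using gA by (auto simp: isos_def Emb_def PiE_def)
    ultimately have "g \<in> Pi\<^sub>E (universe K) U" by (simp add: PiE_iff)
    then show "g \<in> V" using U(3) V'(2) gA by blast
  qed
  moreover have "finite F" using U(1) by (simp add: F_def)
  ultimately show ?thesis by (intro exI[of _ F]) (auto simp: F_def)
qed

end

section \<open>The characterization of CAP\<close>

theorem finite_ramsey_degrees_imp_CAP:
  assumes K: "is_structure L K" "omega_homogeneous L K" and ram: "finite_ramsey_degrees L K"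
  shows "CAP TYPE('x) (aut_group L K) (aut_topology L K)"
  unfolding CAP_def
proof (intro allI impI)
  fix X :: "'x topology" and \<phi>
  assume flow: "flow (aut_group L K) (aut_topology L K) X \<phi>"
  interpret G_flow "aut_group L K" "aut_topology L K" X \<phi>
    by (intro G_flow.intro G_flow_axioms.intro group_aut_group flow)
      (simp add: topspace_aut_topology carrier_aut_group)
  show "closedin X (AP (aut_group L K) (aut_topology L K) X \<phi>)"
  proof (rule closedin_AP)
    fix V assume "openin (aut_topology L K) V" "\<one>\<^bsub>aut_group L K\<^esub> \<in> V"
    then obtain F where F: "finite F" "F \<subseteq> universe K" "pointwise_stabilizer L K F \<subseteq> V"
      using stabilizer_neighborhood_basis by meson
    have "substructure K F \<in> Age L K" by (rule substructure_Age[OF K(1) F(1,2)])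
    then obtain k where "ramsey_bound L K (substructure K F) k"
      using ram unfolding finite_ramsey_degrees_def has_ramsey_degree_def by meson
    then have "few_colors (aut_group L K) (pointwise_stabilizer L K F) k"
      by (rule ramsey_bound_imp_few_colors[OF K F(1,2)])
    with F subgroup_pointwise_stabilizer[OF F(2)]
    show "\<exists>H k. subgroup H (aut_group L K) \<and> H \<subseteq> V \<and> few_colors (aut_group L K) H k"
      by (intro exI[of _ "pointwise_stabilizer L K F"] exI[of _ k]) simp
  qed
qed

theorem CAP_imp_finite_ramsey_degrees:
  fixes L :: "'r language" and K :: "('a, 'r) rel_struct"
  assumes K: "is_structure L K" "omega_homogeneous L K"
    and cap: "CAP TYPE(('a \<Rightarrow> 'a) \<Rightarrow> real) (aut_group L K) (aut_topology L K)"
  shows "finite_ramsey_degrees L K"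
  unfolding finite_ramsey_degrees_def
proof
  fix A assume A: "A \<in> Age L K"
  then obtain a where a: "a \<in> Emb L A K" and fin: "finite (universe A)"
    by (auto simp: Age_def embeds_def)
  let ?F = "a ` universe A"
  have F: "finite ?F" "?F \<subseteq> universe K" using fin Emb_closed[OF a] by auto
  interpret coloring_flow "aut_group L K" "aut_topology L K" "pointwise_stabilizer L K ?F"
    by (rule coloring_flow_stabilizer[OF F])
  obtain k where "few_colors (aut_group L K) (pointwise_stabilizer L K ?F) k"
    using few_colors_if_closedin_AP cap flow_colorings unfolding CAP_def by blast
  then have "ramsey_bound L K A k" by (rule few_colors_imp_ramsey_bound[OF K A a])
  then have "has_ramsey_degree L K A (LEAST k. ramsey_bound L K A k)"
    unfolding has_ramsey_degree_def by (auto intro: LeastI Least_le)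
  then show "\<exists>k. has_ramsey_degree L K A k" by blast
qed

theorem theorem9p4:
  fixes L :: "'r language" and K :: "('a, 'r) rel_struct"
  assumes "is_structure L K" and "omega_homogeneous L K"
  shows "(CAP TYPE(('a \<Rightarrow> 'a) \<Rightarrow> real) (aut_group L K) (aut_topology L K)
            \<longleftrightarrow> finite_ramsey_degrees L K) \<and>
         (finite_ramsey_degrees L K
            \<longrightarrow> CAP TYPE('x) (aut_group L K) (aut_topology L K))"
proof (intro conjI iffI impI)
  show "finite_ramsey_degrees L K"
    if "CAP TYPE(('a \<Rightarrow> 'a) \<Rightarrow> real) (aut_group L K) (aut_topology L K)"
    using that by (rule CAP_imp_finite_ramsey_degrees[OF assms])
qed (rule finite_ramsey_degrees_imp_CAP[OF assms], assumption)+

end
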